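(* Let $A,B>0$ be integers. If the two-state Markov chain $\{X_k\}_{k\ge 1}$ is aperiodic, then $$\mathbb{E}(\tau)=\mathbb{E}(\gamma_1)+a\big[(A+B-2)\alpha-(B-1)\big]+b\big[\mathbb{E}(T)-1\big],$$ where $\alpha=\mathbb{P}(S_\tau=A)$, $$a=\tfrac12\big[\mathbb{E}(\gamma_2\mid X_1=1)-\mathbb{E}(\gamma_2\mid X_1=-1)\big],\qquad b=\tfrac12\big[\mathbb{E}(\gamma_2\mid X_1=1)+\mathbb{E}(\gamma_2\mid X_1=-1)\big].$$
   Context: Let $\{Y_i\}_{i\ge 1}$ be a time-homogeneous irreducible Markov chain with states in a finite alphabet $\Delta$ having at least two letters. Let $U=u_1\dots u_K$ and $D=d_1\dots d_M$ ($K,M\ge 1$) be two distinct words over $\Delta$, neither of which is a contiguous subsequence of the other, such that $$\mathbb{P}(Y_1=u_1,\dots,Y_K=u_K)>0\quad\text{and}\quad \mathbb{P}(Y_1=d_1,\dots,Y_M=d_M)>0.$$ Let $\mathbb{U}_i=0$ for $1\le i<K$ and $\mathbb{U}_i=\mathbb{I}_{Y_{i-K+1}=u_1,\dots,Y_i=u_K}$ for $i\ge K$; let $\mathbb{D}_i=0$ for $1\le i<M$ and $\mathbb{D}_i=\mathbb{I}_{Y_{i-M+1}=d_1,\dots,Y_i=d_M}$ for $i\ge M$. (Here $\mathbb{I}$ denotes the indicator of an event. Both words occur infinitely often almost surely, and they cannot both occur ending at the same time.) Put $S_n=\sum_{i=1}^n(\mathbb{U}_i-\mathbb{D}_i)$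 and, for integers $A,B>0$, $\tau=\min\{n\ge 1: S_n=A\text{ or }S_n=-B\}$. Let $\tau_1=\min\{n\ge 1:\mathbb{U}_n=1\text{ or }\mathbb{D}_n=1\}$ and, for $k>1$, $\tau_k=\min\{n>\tau_{k-1}:\mathbb{U}_n=1\text{ or }\mathbb{D}_n=1\}$. Let $\gamma_1=\tau_1$ and $\gamma_k=\tau_k-\tau_{k-1}$ for $k\ge 2$. Let $X_k=1$ if $\mathbb{U}_{\tau_k}=1$ and $X_k=-1$ if $\mathbb{D}_{\tau_k}=1$. Then $\{X_k\}_{k\ge 1}$ is a time-homogeneous Markov chain with state space $\{1,-1\}$. It is called aperiodic when it is not the perfectly alternating chain, i.e. when it is not the case that both $\mathbb{P}(X_2=-1\mid X_1=1)=1$ and $\mathbb{P}(X_2=1\mid X_1=-1)=1$. Let $T=\min\{k\ge 1: X_1+\cdots+X_k=A\text{ or }X_1+\cdots+X_k=-B\}$. *)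

theory Defs
  imports "HOL-Probability.Probability" "HOL-Library.Sublist"
begin

text \<open>
  Processes are indexed from time 1; the value of \<open>Y 0\<close> is never used. The transition
  probabilities \<open>p x y\<close> are relevant only for \<open>x\<close>, \<open>y\<close> in the state space \<open>\<Delta>\<close>, and the
  initial distribution is arbitrary.
\<close>

definition stochastic_on :: "'a set \<Rightarrow> ('a \<Rightarrow> 'a \<Rightarrow> real) \<Rightarrow> bool" where
  "stochastic_on \<Delta> p \<longleftrightarrow>
     (\<forall>x\<in>\<Delta>. (\<forall>y\<in>\<Delta>. 0 \<le> p x y) \<and> (\<Sum>y\<in>\<Delta>. p x y) = 1)"

definition homogeneous_markov_chain ::
  "'w measure \<Rightarrow> 'a set \<Rightarrow> ('a \<Rightarrow> 'a \<Rightarrow> real) \<Rightarrow> (nat \<Rightarrow> 'w \<Rightarrow> 'a) \<Rightarrow> bool" where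
  "homogeneous_markov_chain M \<Delta> p Y \<longleftrightarrow>
     stochastic_on \<Delta> p \<and>
     (\<forall>i\<ge>1. Y i \<in> measurable M (count_space \<Delta>)) \<and>
     (\<forall>n\<ge>1. \<forall>s. \<forall>y\<in>\<Delta>.
        \<P>(\<omega> in M. \<forall>i\<in>{1..n}. Y i \<omega> = s i) > 0 \<longrightarrow>
        \<P>(\<omega> in M. Y (n + 1) \<omega> = y \<bar> \<forall>i\<in>{1..n}. Y i \<omega> = s i) = p (s n) y)"

primrec n_step :: "'a set \<Rightarrow> ('a \<Rightarrow> 'a \<Rightarrow> real) \<Rightarrow> nat \<Rightarrow> 'a \<Rightarrow> 'a \<Rightarrow> real" where
  "n_step \<Delta> p 0 x y = of_bool (x = y)"
| "n_step \<Delta> p (Suc n) x y = (\<Sum>z\<in>\<Delta>. p x z * n_step \<Delta> p n z y)"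

definition irreducible_on :: "'a set \<Rightarrow> ('a \<Rightarrow> 'a \<Rightarrow> real) \<Rightarrow> bool" where
  "irreducible_on \<Delta> p \<longleftrightarrow> (\<forall>x\<in>\<Delta>. \<forall>y\<in>\<Delta>. \<exists>n. 0 < n_step \<Delta> p n x y)"

text \<open>The word \<open>w\<close> occurs in \<open>Y 1, Y 2, \<dots>\<close> with its last letter at time \<open>i\<close>.\<close>

definition word_ind :: "(nat \<Rightarrow> 'w \<Rightarrow> 'a) \<Rightarrow> 'a list \<Rightarrow> nat \<Rightarrow> 'w \<Rightarrow> int" where
  "word_ind Y w i \<omega> =
     of_bool (length w \<le> i \<and> (\<forall>j<length w. Y (i - length w + 1 + j) \<omega> = w ! j))"

definition score :: "(nat \<Rightarrow> 'w \<Rightarrow> 'a) \<Rightarrow> 'a list \<Rightarrow> 'a list \<Rightarrow> nat \<Rightarrow> 'w \<Rightarrow> int" where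
  "score Y U D n \<omega> = (\<Sum>i=1..n. word_ind Y U i \<omega> - word_ind Y D i \<omega>)"

text \<open>Random times are \<open>enat\<close>-valued: the infimum is the minimum, and is \<open>\<infinity>\<close> on the empty set.\<close>

definition exit_time :: "(nat \<Rightarrow> 'w \<Rightarrow> int) \<Rightarrow> int \<Rightarrow> int \<Rightarrow> 'w \<Rightarrow> enat" where
  "exit_time Z A B \<omega> = Inf {enat n |n. n \<ge> 1 \<and> (Z n \<omega> = A \<or> Z n \<omega> = - B)}"

text \<open>With value 0 at index 0, the first occurrence time is the minimum over all times \<open>n \<ge> 1\<close>.\<close>

primrec occ_time :: "(nat \<Rightarrow> 'w \<Rightarrow> 'a) \<Rightarrow> 'a list \<Rightarrow> 'a list \<Rightarrow> nat \<Rightarrow> 'w \<Rightarrow> enat" where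
  "occ_time Y U D 0 \<omega> = 0"
| "occ_time Y U D (Suc k) \<omega> =
     Inf {enat n |n. enat n > occ_time Y U D k \<omega> \<and>
                     (word_ind Y U n \<omega> = 1 \<or> word_ind Y D n \<omega> = 1)}"

text \<open>Used for \<open>k \<ge> 1\<close>; the first gap is the first occurrence time itself.\<close>

definition gap :: "(nat \<Rightarrow> 'w \<Rightarrow> 'a) \<Rightarrow> 'a list \<Rightarrow> 'a list \<Rightarrow> nat \<Rightarrow> 'w \<Rightarrow> enat" where
  "gap Y U D k \<omega> = occ_time Y U D k \<omega> - occ_time Y U D (k - 1) \<omega>"

text \<open>The value 0 only marks the case that there is no \<open>k\<close>-th occurrence.\<close>

definition occ_sign :: "(nat \<Rightarrow> 'w \<Rightarrow> 'a) \<Rightarrow> 'a list \<Rightarrow> 'a list \<Rightarrow> nat \<Rightarrow> 'w \<Rightarrow> int" where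
  "occ_sign Y U D k \<omega> =
     (case occ_time Y U D k \<omega> of
        enat n \<Rightarrow> if word_ind Y U n \<omega> = 1 then 1
                  else if word_ind Y D n \<omega> = 1 then - 1 else 0
      | \<infinity> \<Rightarrow> 0)"

text \<open>Not the perfectly alternating chain (this is not aperiodicity in terms of return times).\<close>

definition aperiodic_signs :: "'w measure \<Rightarrow> (nat \<Rightarrow> 'w \<Rightarrow> int) \<Rightarrow> bool" where
  "aperiodic_signs M X \<longleftrightarrow>
     \<not> (\<P>(\<omega> in M. X 2 \<omega> = - 1 \<bar> X 1 \<omega> = 1) = 1 \<and>
        \<P>(\<omega> in M. X 2 \<omega> = 1 \<bar> X 1 \<omega> = - 1) = 1)"

definition mean_time :: "'w measure \<Rightarrow> ('w \<Rightarrow> enat) \<Rightarrow> ennreal" where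
  "mean_time M N = (\<integral>\<^sup>+ \<omega>. ennreal_of_enat (N \<omega>) \<partial>M)"

definition cond_mean_time :: "'w measure \<Rightarrow> ('w \<Rightarrow> enat) \<Rightarrow> ('w \<Rightarrow> bool) \<Rightarrow> ennreal" where
  "cond_mean_time M N Q = mean_time (uniform_measure M {\<omega>\<in>space M. Q \<omega>}) N"

end

theory Submission imports Defs begin

text \<open>
  Since no pattern contains the other, the future after an occurrence of \<open>w\<close> depends on the past
  only through \<open>w\<close>. Let \<open>g\<^sub>w n\<close> be the probability that no pattern ends within \<open>n\<close> steps
  after \<open>w\<close>, and \<open>v\<^sub>w j\<close> the probability that \<open>w\<close> ends at time \<open>j\<close> while the score has not
  yet left the strip. Splitting \<open>{\<tau> > n}\<close> at the last occurrence up to time \<open>n\<close> gives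
  \<open>P(\<tau> > n) = P(\<gamma>\<^sub>1 > n) + \<Sum>\<^sub>w \<Sum>\<^sub>j v\<^sub>w j * g\<^sub>w (n - j)\<close>, and summing this convolution over \<open>n\<close>,
  \<open>E \<tau> = E \<gamma>\<^sub>1 + \<Sum>\<^sub>w V\<^sub>w * G\<^sub>w\<close>, where \<open>G\<^sub>w\<close> is the mean gap after \<open>w\<close>. Counting the occurrences
  strictly before \<open>\<tau>\<close> gives \<open>V\<^sub>U + V\<^sub>D = E T - 1\<close>, and \<open>V\<^sub>U - V\<^sub>D\<close> is the mean of the score just before
  exit, which is \<open>A - 1\<close> or \<open>1 - B\<close>. All means are finite because the relevant tail probabilities
  contract by a fixed factor over blocks of bounded length.
\<close>

section \<open>Contracting series, infima of sets of times, and tail sums\<close>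

text \<open>Each partial sum is at most the first \<open>N\<close> terms plus \<open>c\<close> times
  itself; solving for it gives a uniform bound. The contraction is over blocks of \<open>N\<close>
  steps because a single step of the chain need not shrink a tail probability by a fixed
  factor.\<close>

lemma summable_if_contracting:
  fixes f :: "nat \<Rightarrow> real"
  assumes "\<And>n. 0 \<le> f n" and "\<And>n. f (n + N) \<le> c * f n" and "c < 1"
  shows "summable f"
proof (rule summableI_nonneg_bounded)
  fix n
  have "sum f {..<n} \<le> sum f {..<n + N}"
    using assms(1) by (intro sum_mono2) auto
  also have "\<dots> = sum f {..<N} + (\<Sum>k<n. f (k + N))"
    by (induction n) (auto simp: ac_simps)
  also have "\<dots> \<le> sum f {..<N} + c * sum f {..<n}"
    using assms(2) by (auto simp: sum_distrib_left intro!: sum_mono)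
  finally show "sum f {..<n} \<le> sum f {..<N} / (1 - c)"
    using assms(3) by (simp add: field_simps)
qed (use assms in auto)

text \<open>All random times here are infima of this shape and their means are sums of tails. Since
  the infimum of the empty set is \<open>\<infinity>\<close>, the tail event has the same
  description whether or not the time is finite.\<close>

lemma less_Inf_enat_iff:
  "enat n < Inf {enat k |k. P k} \<longleftrightarrow> (\<forall>k\<le>n. \<not> P k)"
proof (cases "\<exists>k. P k")
  case True
  then have "{enat k |k. P k} \<noteq> {}" by simp
  then have "Inf {enat k |k. P k} \<in> {enat k |k. P k}"
    by (meson equals0I wellorder_InfI)
  then obtain k where k: "P k" "Inf {enat k |k. P k} = enat k" by auto
  have "Inf {enat k |k. P k} \<le> enat i" if "P i" for i
    using that by (intro Inf_lower) auto
  then show ?thesis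
    using k by (metis enat_ord_simps leD leI order_less_le_trans)
qed (auto simp: top_enat_def)

lemma Inf_enat_eq_iff:
  "Inf {enat k |k. P k} = enat n \<longleftrightarrow> P n \<and> (\<forall>k<n. \<not> P k)"
proof -
  let ?I = "Inf {enat k |k. P k}"
  have "?I = enat n \<longleftrightarrow> (\<forall>k. enat k < ?I \<longleftrightarrow> k < n)"
  proof
    assume *: "\<forall>k. enat k < ?I \<longleftrightarrow> k < n"
    show "?I = enat n"
    proof (cases ?I)
      case (enat i)
      with * show ?thesis by (metis enat_ord_simps(2) less_irrefl linorder_neqE_nat)
    qed (use * in auto)
  qed simp
  also have "\<dots> \<longleftrightarrow> P n \<and> (\<forall>k<n. \<not> P k)"
    unfolding less_Inf_enat_iff
  proof
    assume *: "\<forall>k. (\<forall>j\<le>k. \<not> P j) \<longleftrightarrow> k < n"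
    then obtain j where "j \<le> n" "P j" by blast
    with * show "P n \<and> (\<forall>k<n. \<not> P k)"
      by (metis order_refl order_le_less)
  next
    assume "P n \<and> (\<forall>k<n. \<not> P k)"
    then show "\<forall>k. (\<forall>j\<le>k. \<not> P j) \<longleftrightarrow> k < n"
      by (auto simp: not_less[symmetric])
  qed
  finally show ?thesis .
qed

lemma ennreal_of_enat_eq_suminf:
  "ennreal_of_enat N = (\<Sum>n. of_bool (enat n < N))"
proof (cases N)
  case (enat k)
  have "(\<Sum>n. of_bool (enat n < N) :: ennreal) = (\<Sum>n<k. of_bool (enat n < N))"
    by (rule suminf_finite) (auto simp: enat)
  also have "\<dots> = of_nat k" by (simp add: enat)
  finally show ?thesis by (simp add: enat)
next
  case infinity
  have "(\<Sum>n. 1 :: ennreal) = (\<integral>\<^sup>+ n. 1 \<partial>count_space (UNIV :: nat set))"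
    by (rule nn_integral_count_space_nat[symmetric])
  also have "\<dots> = \<infinity>" by simp
  finally have "(\<Sum>n. 1 :: ennreal) = \<infinity>" .
  then show ?thesis by (simp add: infinity)
qed

text \<open>The pointwise tail-sum identity is integrated term by term. The probability space is an
  explicit assumption so that the rule also applies to a conditioned measure.\<close>

lemma mean_time_sums:
  assumes "prob_space M" and N: "\<And>n. {\<omega>\<in>space M. enat n < N \<omega>} \<in> sets M"
    and f: "\<And>n. measure M {\<omega>\<in>space M. enat n < N \<omega>} = f n" and "f sums s"
  shows "mean_time M N = ennreal s"
proof -
  interpret prob_space M by fact
  have "mean_time M N = (\<integral>\<^sup>+ \<omega>. (\<Sum>n. indicator {\<omega>\<in>space M. enat n < N \<omega>} \<omega>) \<partial>M)"
    unfolding mean_time_def ennreal_of_enat_eq_suminf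
    by (intro nn_integral_cong arg_cong[where f = suminf]) (auto simp: indicator_def fun_eq_iff)
  also have "\<dots> = (\<Sum>n. emeasure M {\<omega>\<in>space M. enat n < N \<omega>})"
    using N by (subst nn_integral_suminf) auto
  also have "\<dots> = (\<Sum>n. ennreal (f n))"
    by (simp add: emeasure_eq_measure f)
  also have "\<dots> = ennreal s"
  proof (rule suminf_ennreal_eq)
    show "0 \<le> f n" for n
      unfolding f[symmetric] by (rule measure_nonneg)
  qed fact
  finally show ?thesis .
qed

section \<open>Path probabilities\<close>

primrec path_prob :: "('a \<Rightarrow> 'a \<Rightarrow> real) \<Rightarrow> 'a \<Rightarrow> 'a list \<Rightarrow> real" where
  "path_prob p x [] = 1"
| "path_prob p x (y # r) = p x y * path_prob p y r"

lemma path_prob_append: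
  "path_prob p x (r @ r') = path_prob p x r * path_prob p (last (x # r)) r'"
  by (induction r arbitrary: x) auto

definition words :: "'a set \<Rightarrow> nat \<Rightarrow> 'a list set" where
  "words \<Delta> n = {l. set l \<subseteq> \<Delta> \<and> length l = n}"

lemma words_0 [simp]: "words \<Delta> 0 = {[]}"
  by (auto simp: words_def)

lemma finite_words: "finite \<Delta> \<Longrightarrow> finite (words \<Delta> n)"
  using finite_lists_length_eq[of \<Delta> n] by (simp add: words_def)

lemma sum_words_add:
  "(\<Sum>l\<in>words \<Delta> (m + n). f l) = (\<Sum>l\<in>words \<Delta> m. \<Sum>r\<in>words \<Delta> n. f (l @ r))"
proof -
  have "(\<Sum>l\<in>words \<Delta> (m + n). f l) = (\<Sum>(l, r)\<in>words \<Delta> m \<times> words \<Delta> n. f (l @ r))"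
    by (rule sum.reindex_bij_witness[of _ "\<lambda>(l, r). l @ r" "\<lambda>l. (take m l, drop m l)"])
      (auto simp: words_def dest: in_set_takeD in_set_dropD)
  then show ?thesis by (simp add: sum.cartesian_product)
qed

lemma sum_words_1: "(\<Sum>l\<in>words \<Delta> (Suc 0). f l) = (\<Sum>y\<in>\<Delta>. f [y])"
  by (rule sum.reindex_bij_witness[of _ "\<lambda>y. [y]" hd]) (auto simp: words_def length_Suc_conv)

context
  fixes \<Delta> :: "'a set" and p :: "'a \<Rightarrow> 'a \<Rightarrow> real"
  assumes fin: "finite \<Delta>" and stoch: "stochastic_on \<Delta> p"
begin

lemma path_prob_nonneg: "x \<in> \<Delta> \<Longrightarrow> set r \<subseteq> \<Delta> \<Longrightarrow> 0 \<le> path_prob p x r"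
  using stoch by (induction r arbitrary: x) (auto simp: stochastic_on_def)

lemma sum_path_prob: "x \<in> \<Delta> \<Longrightarrow> (\<Sum>r\<in>words \<Delta> n. path_prob p x r) = 1"
proof (induction n arbitrary: x)
  case (Suc n)
  have "(\<Sum>r\<in>words \<Delta> (Suc n). path_prob p x r) = (\<Sum>y\<in>\<Delta>. p x y * (\<Sum>r\<in>words \<Delta> n. path_prob p y r))"
    using sum_words_add[of "path_prob p x" \<Delta> "Suc 0" n]
    by (simp add: sum_words_1 sum_distrib_left)
  then show ?case using Suc stoch by (simp add: stochastic_on_def)
qed simp

text \<open>The letters after the prefix are summed out, as they carry total probability
  one.\<close>

lemma sum_path_prob_prefix:
  assumes "x \<in> \<Delta>" "set r \<subseteq> \<Delta>" "length r \<le> n"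
  shows "(\<Sum>l\<in>words \<Delta> n. of_bool (prefix r l) * path_prob p x l) = path_prob p x r"
proof -
  have r: "r \<in> words \<Delta> (length r)" using assms by (simp add: words_def)
  have last: "last (x # r) \<in> \<Delta>" using assms by auto
  have "(\<Sum>l\<in>words \<Delta> n. of_bool (prefix r l) * path_prob p x l)
      = (\<Sum>l\<in>words \<Delta> (length r). \<Sum>l'\<in>words \<Delta> (n - length r). of_bool (prefix r (l @ l')) * path_prob p x (l @ l'))"
    using sum_words_add[of "\<lambda>l. of_bool (prefix r l) * path_prob p x l" \<Delta> "length r" "n - length r"] assms
    by simp
  also have "\<dots> = (\<Sum>l\<in>words \<Delta> (length r). if l = r then path_prob p x r else 0)"
  proof (intro sum.cong refl)
    fix l assume l: "l \<in> words \<Delta> (length r)"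
    then have "prefix r (l @ l') \<longleftrightarrow> l = r" for l'
      by (metis (mono_tags, lifting) append_eq_append_conv mem_Collect_eq prefixE prefixI words_def)
    then show "(\<Sum>l'\<in>words \<Delta> (n - length r). of_bool (prefix r (l @ l')) * path_prob p x (l @ l'))
      = (if l = r then path_prob p x r else 0)"
      using sum_path_prob[OF last, of "n - length r"]
      by (cases "l = r") (simp_all add: path_prob_append del: last.simps flip: sum_distrib_left)
  qed
  also have "\<dots> = path_prob p x r"
    using r fin by (simp add: finite_words)
  finally show ?thesis .
qed

text \<open>From every letter some continuation of positive probability destroys \<open>Q\<close>,
  whatever came before. As \<open>\<Delta>\<close> is finite, these continuations have length at
  most \<open>N\<close> and probability at least \<open>\<delta>\<close>, so \<open>Q\<close>
  survives \<open>N\<close> more letters with conditional probability at most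
  \<open>1 - \<delta>\<close>.\<close>

lemma summable_avoidance:
  assumes x: "x \<in> \<Delta>" and mono: "\<And>r r'. Q (r @ r') \<Longrightarrow> Q r"
    and reach: "\<And>y. y \<in> \<Delta> \<Longrightarrow> \<exists>r. set r \<subseteq> \<Delta> \<and> path_prob p y r > 0 \<and>
      (\<forall>l. set l \<subseteq> \<Delta> \<longrightarrow> last (x # l) = y \<longrightarrow> \<not> Q (l @ r))"
  shows "summable (\<lambda>n. \<Sum>r\<in>words \<Delta> n. of_bool (Q r) * path_prob p x r)"
proof -
  obtain R where R: "\<And>y. y \<in> \<Delta> \<Longrightarrow> set (R y) \<subseteq> \<Delta>" "\<And>y. y \<in> \<Delta> \<Longrightarrow> path_prob p y (R y) > 0"
    "\<And>y l. y \<in> \<Delta> \<Longrightarrow> set l \<subseteq> \<Delta> \<Longrightarrow> last (x # l) = y \<Longrightarrow> \<not> Q (l @ R y)"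
    using reach by metis
  define N where "N = Max ((\<lambda>y. length (R y)) ` \<Delta>)"
  define \<delta> where "\<delta> = Min ((\<lambda>y. path_prob p y (R y)) ` \<Delta>)"
  have N: "length (R y) \<le> N" if "y \<in> \<Delta>" for y
    using that fin by (auto simp: N_def)
  have \<delta>: "\<delta> \<le> path_prob p y (R y)" if "y \<in> \<Delta>" for y
    using that fin by (auto simp: \<delta>_def)
  have \<delta>_pos: "\<delta> > 0"
    using R(2) x fin by (subst \<delta>_def, subst Min_gr_iff) auto
  have avoid: "(\<Sum>r\<in>words \<Delta> N. of_bool (\<not> prefix (R y) r) * path_prob p y r) \<le> 1 - \<delta>" if "y \<in> \<Delta>" for y
  proof -
    have "(\<Sum>r\<in>words \<Delta> N. of_bool (\<not> prefix (R y) r) * path_prob p y r)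
        = (\<Sum>r\<in>words \<Delta> N. path_prob p y r) - (\<Sum>r\<in>words \<Delta> N. of_bool (prefix (R y) r) * path_prob p y r)"
      unfolding sum_subtractf[symmetric] by (intro sum.cong) auto
    then show ?thesis
      using sum_path_prob[OF that] sum_path_prob_prefix[OF that R(1)[OF that] N[OF that]] \<delta>[OF that] by simp
  qed
  show ?thesis
  proof (rule summable_if_contracting[where c = "1 - \<delta>" and N = N])
    show "0 \<le> (\<Sum>r\<in>words \<Delta> n. of_bool (Q r) * path_prob p x r)" for n
      using x by (intro sum_nonneg mult_nonneg_nonneg path_prob_nonneg) (auto simp: words_def)
  next
    fix n
    have "(\<Sum>r\<in>words \<Delta> (n + N). of_bool (Q r) * path_prob p x r)
        = (\<Sum>r\<in>words \<Delta> n. \<Sum>r'\<in>words \<Delta> N. of_bool (Q (r @ r')) * path_prob p x (r @ r'))"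
      by (rule sum_words_add)
    also have "\<dots> \<le> (\<Sum>r\<in>words \<Delta> n. of_bool (Q r) * path_prob p x r *
        (\<Sum>r'\<in>words \<Delta> N. of_bool (\<not> prefix (R (last (x # r))) r') * path_prob p (last (x # r)) r'))"
      unfolding sum_distrib_left
    proof (intro sum_mono)
      fix r r' assume r: "r \<in> words \<Delta> n" and r': "r' \<in> words \<Delta> N"
      let ?y = "last (x # r)"
      have y: "?y \<in> \<Delta>" and rr: "set r \<subseteq> \<Delta>" using r x by (auto simp: words_def)
      \<comment> \<open>If \<open>r'\<close> began with \<open>R ?y\<close>, then
        \<open>Q (r @ R ?y)\<close> would follow by cutting off the remaining letters, contrary to
        the choice of \<open>R\<close>.\<close>
      have "Q (r @ r') \<Longrightarrow> Q r \<and> \<not> prefix (R ?y) r'"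
        using mono[of r r'] mono[of "r @ R ?y"] R(3)[OF y rr refl] by (auto simp: prefix_def)
      moreover have "0 \<le> path_prob p x r * path_prob p ?y r'"
        using rr r' y x by (intro mult_nonneg_nonneg path_prob_nonneg) (auto simp: words_def)
      ultimately show "of_bool (Q (r @ r')) * path_prob p x (r @ r')
        \<le> of_bool (Q r) * path_prob p x r * (of_bool (\<not> prefix (R ?y) r') * path_prob p ?y r')"
        by (auto simp: path_prob_append)
    qed
    also have "\<dots> \<le> (\<Sum>r\<in>words \<Delta> n. of_bool (Q r) * path_prob p x r * (1 - \<delta>))"
      using x by (intro sum_mono mult_left_mono avoid mult_nonneg_nonneg path_prob_nonneg) (auto simp: words_def)
    also have "\<dots> = (1 - \<delta>) * (\<Sum>r\<in>words \<Delta> n. of_bool (Q r) * path_prob p x r)"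
      unfolding sum_distrib_right[symmetric] by (rule mult.commute)
    finally show "(\<Sum>r\<in>words \<Delta> (n + N). of_bool (Q r) * path_prob p x r)
        \<le> (1 - \<delta>) * (\<Sum>r\<in>words \<Delta> n. of_bool (Q r) * path_prob p x r)" .
  qed (use \<delta>_pos in simp)
qed

lemma n_step_path:
  assumes "x \<in> \<Delta>" "0 < n_step \<Delta> p n x y"
  shows "\<exists>r. set r \<subseteq> \<Delta> \<and> path_prob p x r > 0 \<and> last (x # r) = y"
  using assms
proof (induction n arbitrary: x)
  case 0
  then show ?case by (intro exI[of _ "[]"]) (auto split: if_splits)
next
  case (Suc n)
  then have "\<exists>z\<in>\<Delta>. 0 < p x z * n_step \<Delta> p n z y"
    using sum_nonpos[of \<Delta> "\<lambda>z. p x z * n_step \<Delta> p n z y"] by (force simp: not_less)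
  then obtain z where z: "z \<in> \<Delta>" "0 < p x z * n_step \<Delta> p n z y" by blast
  moreover have "0 \<le> p x z" using z Suc.prems stoch by (auto simp: stochastic_on_def)
  ultimately have pos: "0 < p x z" "0 < n_step \<Delta> p n z y"
    by (auto simp: zero_less_mult_iff)
  with Suc.IH[OF z(1)] obtain r where r: "set r \<subseteq> \<Delta>" "path_prob p z r > 0" "last (z # r) = y" by auto
  show ?case using z r pos by (intro exI[of _ "z # r"]) auto
qed

lemma reach_word:
  assumes irr: "irreducible_on \<Delta> p" and x: "x \<in> \<Delta>"
    and w: "set (u # w) \<subseteq> \<Delta>" "path_prob p u w > 0"
  shows "\<exists>r. set r \<subseteq> \<Delta> \<and> path_prob p x r > 0 \<and> suffix (u # w) r"
proof -
  \<comment> \<open>One step to \<open>z\<close> is made first: irreducibility may supply the empty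
    path, and from \<open>x = u\<close> this would leave the letter \<open>u\<close> out of the
    continuation.\<close>
  have "0 < (\<Sum>z\<in>\<Delta>. p x z)" using x stoch by (simp add: stochastic_on_def)
  then obtain z where z: "z \<in> \<Delta>" "0 < p x z"
    using sum_nonpos[of \<Delta> "p x"] by (force simp: not_less)
  obtain n where "0 < n_step \<Delta> p n z u"
    using irr z(1) w(1) unfolding irreducible_on_def by fastforce
  then obtain r where r: "set r \<subseteq> \<Delta>" "path_prob p z r > 0" "last (z # r) = u"
    using n_step_path z by blast
  have "z # r = butlast (z # r) @ [u]"
    using r(3) append_butlast_last_id[of "z # r"] by simp
  then have "suffix (u # w) (z # r @ w)" 
    by (intro suffixI[of _ "butlast (z # r)"]) (metis append.assoc append_Cons append_Nil)
  then show ?thesis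
    using r z w by (intro exI[of _ "z # r @ w"]) (auto simp: path_prob_append)
qed

end

section \<open>Finite Markov chains\<close>

locale finite_chain = prob_space M for M :: "'w measure" +
  fixes \<Delta> :: "'a set" and p :: "'a \<Rightarrow> 'a \<Rightarrow> real" and Y :: "nat \<Rightarrow> 'w \<Rightarrow> 'a"
  assumes fin: "finite \<Delta>" and chain: "homogeneous_markov_chain M \<Delta> p Y"
begin

text \<open>Turning the past into a finite word makes the events of interest predicates on words, so
  their probabilities become finite sums.\<close>

definition history :: "nat \<Rightarrow> 'w \<Rightarrow> 'a list" where
  "history n \<omega> = map (\<lambda>i. Y i \<omega>) [1..<Suc n]"

lemma stoch: "stochastic_on \<Delta> p"
  using chain by (simp add: homogeneous_markov_chain_def)

lemma length_history [simp]: "length (history n \<omega>) = n"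
  by (simp add: history_def)

lemma history_0 [simp]: "history 0 \<omega> = []"
  by (simp add: history_def)

lemma history_Suc: "history (Suc n) \<omega> = history n \<omega> @ [Y (Suc n) \<omega>]"
  by (simp add: history_def)

lemma nth_history: "i < n \<Longrightarrow> history n \<omega> ! i = Y (Suc i) \<omega>"
  by (simp add: history_def del: upt_Suc)

lemma take_history [simp]: "take i (history n \<omega>) = history (min i n) \<omega>"
  by (intro nth_equalityI) (auto simp: nth_history)

lemma measurable_Y: "i \<ge> 1 \<Longrightarrow> Y i \<in> measurable M (count_space \<Delta>)"
  using chain by (simp add: homogeneous_markov_chain_def)

lemma history_in_words: "\<omega> \<in> space M \<Longrightarrow> history n \<omega> \<in> words \<Delta> n"
  using measurable_space[OF measurable_Y] by (auto simp: words_def history_def)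

text \<open>An arbitrary predicate \<open>Q\<close> is allowed because the history takes only
  finitely many values on \<open>space M\<close>. Later events become measurable as soon as they are
  written through \<open>history\<close>.\<close>

lemma sets_history [measurable]: "{\<omega>\<in>space M. Q (history n \<omega>)} \<in> sets M"
proof -
  have *: "{\<omega>\<in>space M. history n \<omega> = l} \<in> sets M" for l
  proof (cases "length l = n")
    case True
    then have "history n \<omega> = l \<longleftrightarrow> (\<forall>i<n. Y (Suc i) \<omega> = l ! i)" for \<omega>
      by (auto simp: list_eq_iff_nth_eq nth_history)
    moreover have "{\<omega>\<in>space M. Y (Suc i) \<omega> = l ! i} \<in> sets M" for i
    proof (cases "l ! i \<in> \<Delta>")
      case True
      then show ?thesis
        using measurable_sets[OF measurable_Y[of "Suc i"], of "{l ! i}"]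
        by (simp add: vimage_def Int_def conj_commute)
    next
      case False
      then have "Y (Suc i) \<omega> \<noteq> l ! i" if "\<omega> \<in> space M" for \<omega>
        using measurable_space[OF measurable_Y[of "Suc i"] that] by auto
      then have "{\<omega>\<in>space M. Y (Suc i) \<omega> = l ! i} = {}" by blast
      then show ?thesis by (simp only: sets.empty_sets)
    qed
    ultimately show ?thesis by simp
  next
    case False
    then have "{\<omega>\<in>space M. history n \<omega> = l} = {}" by auto
    then show ?thesis by (simp only: sets.empty_sets)
  qed
  have "{\<omega>\<in>space M. Q (history n \<omega>)} = (\<Union>l\<in>{l\<in>words \<Delta> n. Q l}. {\<omega>\<in>space M. history n \<omega> = l})"
    using history_in_words by auto
  also have "\<dots> \<in> sets M"
    using * fin by (intro sets.finite_UN) (auto simp: finite_words)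
  finally show ?thesis .
qed

lemma prob_history:
  "\<P>(\<omega> in M. Q (history n \<omega>)) = (\<Sum>l\<in>words \<Delta> n. of_bool (Q l) * \<P>(\<omega> in M. history n \<omega> = l))"
proof -
  have "{\<omega>\<in>space M. Q (history n \<omega>)} = (\<Union>l\<in>{l\<in>words \<Delta> n. Q l}. {\<omega>\<in>space M. history n \<omega> = l})"
    using history_in_words by auto
  then have "\<P>(\<omega> in M. Q (history n \<omega>)) = (\<Sum>l\<in>{l\<in>words \<Delta> n. Q l}. \<P>(\<omega> in M. history n \<omega> = l))"
    using fin by (simp, intro finite_measure_finite_Union) (auto simp: finite_words disjoint_family_on_def)
  also have "\<dots> = (\<Sum>l\<in>words \<Delta> n. of_bool (Q l) * \<P>(\<omega> in M. history n \<omega> = l))"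
    using fin by (intro sum.mono_neutral_cong_left) (auto simp: finite_words)
  finally show ?thesis .
qed

lemma prob_history_snoc:
  assumes "length l = n" "n > 0" "y \<in> \<Delta>"
  shows "\<P>(\<omega> in M. history (Suc n) \<omega> = l @ [y]) = \<P>(\<omega> in M. history n \<omega> = l) * p (last l) y"
proof -
  define s where "s i = l ! (i - 1)" for i
  have eq: "history n \<omega> = l \<longleftrightarrow> (\<forall>i\<in>{1..n}. Y i \<omega> = s i)" for \<omega>
  proof
    assume "history n \<omega> = l"
    then show "\<forall>i\<in>{1..n}. Y i \<omega> = s i"
      using nth_history[of _ n \<omega>] by (auto simp: s_def)
  next
    assume *: "\<forall>i\<in>{1..n}. Y i \<omega> = s i"
    show "history n \<omega> = l"
      using assms(1) * by (intro nth_equalityI) (auto simp: nth_history s_def)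
  qed
  have last: "last l = s n" using assms by (cases l rule: rev_cases) (auto simp: s_def)
  have Suc: "history (Suc n) \<omega> = l @ [y] \<longleftrightarrow> Y (n + 1) \<omega> = y \<and> (\<forall>i\<in>{1..n}. Y i \<omega> = s i)" for \<omega>
    using assms unfolding eq[symmetric] by (auto simp: history_Suc)
  show ?thesis
  proof (cases "\<P>(\<omega> in M. history n \<omega> = l) > 0")
    case True
    then have "\<P>(\<omega> in M. Y (n + 1) \<omega> = y \<bar> \<forall>i\<in>{1..n}. Y i \<omega> = s i) = p (s n) y"
      using chain assms unfolding homogeneous_markov_chain_def eq by auto
    then show ?thesis
      using True unfolding cond_prob_def Suc last unfolding eq by (auto simp: field_simps)
  next
    \<comment> \<open>The transition rule is available only after a past of positive probability;
      otherwise both sides vanish.\<close>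
    case False
    then have 0: "\<P>(\<omega> in M. history n \<omega> = l) = 0"
      by (simp add: not_less measure_le_0_iff)
    moreover have "\<P>(\<omega> in M. history (Suc n) \<omega> = l @ [y]) \<le> \<P>(\<omega> in M. history n \<omega> = l)"
      using assms by (intro finite_measure_mono) (auto simp: history_Suc)
    ultimately show ?thesis by (simp add: measure_le_0_iff)
  qed
qed

lemma prob_history_append:
  assumes "length l = n" "n > 0" "r \<in> words \<Delta> m"
  shows "\<P>(\<omega> in M. history (n + m) \<omega> = l @ r) = \<P>(\<omega> in M. history n \<omega> = l) * path_prob p (last l) r"
  using assms
proof (induction r arbitrary: l n m)
  case (Cons y r)
  then have m: "m = Suc (m - 1)" "r \<in> words \<Delta> (m - 1)" "y \<in> \<Delta>" by (auto simp: words_def)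
  have "\<P>(\<omega> in M. history (Suc n + (m - 1)) \<omega> = (l @ [y]) @ r)
      = \<P>(\<omega> in M. history (Suc n) \<omega> = l @ [y]) * path_prob p (last (l @ [y])) r"
    using Cons m by (intro Cons.IH) auto
  also have "Suc n + (m - 1) = n + m" using m by linarith
  finally show ?case
    using prob_history_snoc[OF Cons.prems(1,2) m(3)] by simp
qed (auto simp: words_def)

text \<open>The Markov property in the form used below: once the first \<open>n\<close> letters are
  fixed, the rest is a path started from the last of them.\<close>

lemma prob_history_add:
  assumes "n > 0"
  shows "\<P>(\<omega> in M. Q (history (n + m) \<omega>)) =
    (\<Sum>l\<in>words \<Delta> n. \<P>(\<omega> in M. history n \<omega> = l) * (\<Sum>r\<in>words \<Delta> m. of_bool (Q (l @ r)) * path_prob p (last l) r))"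
proof -
  have "\<P>(\<omega> in M. Q (history (n + m) \<omega>)) =
      (\<Sum>l\<in>words \<Delta> n. \<Sum>r\<in>words \<Delta> m. of_bool (Q (l @ r)) * \<P>(\<omega> in M. history (n + m) \<omega> = l @ r))"
    by (subst prob_history) (rule sum_words_add)
  also have "\<dots> = (\<Sum>l\<in>words \<Delta> n. \<Sum>r\<in>words \<Delta> m.
      of_bool (Q (l @ r)) * (\<P>(\<omega> in M. history n \<omega> = l) * path_prob p (last l) r))"
    using assms prob_history_append by (intro sum.cong refl) (auto simp: words_def)
  also have "\<dots> = (\<Sum>l\<in>words \<Delta> n. \<P>(\<omega> in M. history n \<omega> = l) *
      (\<Sum>r\<in>words \<Delta> m. of_bool (Q (l @ r)) * path_prob p (last l) r))"
    by (simp add: sum_distrib_left mult.left_commute)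
  finally show ?thesis .
qed

text \<open>The initial law is arbitrary, so the first letter is split off and the avoidance bound
  is applied from each possible \<open>x\<close>; this costs an index shift by one.\<close>

lemma summable_prob_history:
  assumes mono: "\<And>l r. Q (l @ r) \<Longrightarrow> Q l"
    and reach: "\<And>y. y \<in> \<Delta> \<Longrightarrow> \<exists>r. set r \<subseteq> \<Delta> \<and> path_prob p y r > 0 \<and>
      (\<forall>l. set l \<subseteq> \<Delta> \<longrightarrow> l \<noteq> [] \<longrightarrow> last l = y \<longrightarrow> \<not> Q (l @ r))"
  shows "summable (\<lambda>n. \<P>(\<omega> in M. Q (history n \<omega>)))"
proof -
  have "summable (\<lambda>n. \<P>(\<omega> in M. history (Suc 0) \<omega> = [x]) *
      (\<Sum>r\<in>words \<Delta> n. of_bool (Q (x # r)) * path_prob p x r))" if x: "x \<in> \<Delta>" for x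
  proof (intro summable_mult summable_avoidance[OF fin stoch x])
    show "Q (x # r)" if "Q (x # r @ r')" for r r'
      using that mono[of "x # r" r'] by simp
    show "\<exists>r. set r \<subseteq> \<Delta> \<and> path_prob p y r > 0 \<and>
      (\<forall>l. set l \<subseteq> \<Delta> \<longrightarrow> last (x # l) = y \<longrightarrow> \<not> Q (x # l @ r))" if y: "y \<in> \<Delta>" for y
    proof -
      obtain r where r: "set r \<subseteq> \<Delta>" "path_prob p y r > 0"
        and *: "\<And>l. set l \<subseteq> \<Delta> \<Longrightarrow> l \<noteq> [] \<Longrightarrow> last l = y \<Longrightarrow> \<not> Q (l @ r)"
        using reach[OF y] by auto
      have "\<not> Q (x # l @ r)" if "set l \<subseteq> \<Delta>" "last (x # l) = y" for l
        using *[of "x # l"] that x by simp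
      with r show ?thesis by blast
    qed
  qed
  then have "summable (\<lambda>n. \<Sum>x\<in>\<Delta>. \<P>(\<omega> in M. history (Suc 0) \<omega> = [x]) *
      (\<Sum>r\<in>words \<Delta> n. of_bool (Q (x # r)) * path_prob p x r))"
    by (intro summable_sum)
  moreover have "(\<Sum>x\<in>\<Delta>. \<P>(\<omega> in M. history (Suc 0) \<omega> = [x]) *
      (\<Sum>r\<in>words \<Delta> n. of_bool (Q (x # r)) * path_prob p x r)) = \<P>(\<omega> in M. Q (history (Suc n) \<omega>))" for n
    using prob_history_add[of "Suc 0" Q n] by (simp add: sum_words_1)
  ultimately have "summable (\<lambda>n. \<P>(\<omega> in M. Q (history (Suc n) \<omega>)))" by simp
  then show ?thesis by (subst (asm) summable_Suc_iff)
qed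

text \<open>The probability that \<open>Q\<close> holds forever is below each term of a series whose
  terms tend to 0.\<close>

lemma AE_history_finite:
  assumes "summable (\<lambda>n. \<P>(\<omega> in M. Q (history n \<omega>)))"
  shows "AE \<omega> in M. \<exists>n. \<not> Q (history n \<omega>)"
proof -
  have "(\<lambda>n. \<P>(\<omega> in M. Q (history n \<omega>))) \<longlonglongrightarrow> 0"
    using assms by (rule summable_LIMSEQ_zero)
  moreover have "\<P>(\<omega> in M. \<forall>n. Q (history n \<omega>)) \<le> \<P>(\<omega> in M. Q (history n \<omega>))" for n
    by (intro finite_measure_mono) auto
  ultimately have "\<P>(\<omega> in M. \<forall>n. Q (history n \<omega>)) \<le> 0"
    by (intro LIMSEQ_le_const) auto
  then have "\<P>(\<omega> in M. \<forall>n. Q (history n \<omega>)) = 0"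
    by (simp add: measure_le_0_iff)
  then have "AE \<omega> in M. \<not> (\<forall>n. Q (history n \<omega>))"
    by (subst (asm) prob_eq_0) auto
  then show ?thesis by simp
qed

end

section \<open>Occurrences of two patterns\<close>

locale two_patterns = finite_chain M \<Delta> p Y
  for M :: "'w measure" and \<Delta> :: "'a set" and p :: "'a \<Rightarrow> 'a \<Rightarrow> real" and Y :: "nat \<Rightarrow> 'w \<Rightarrow> 'a" +
  fixes U D :: "'a list"
  assumes irr: "irreducible_on \<Delta> p"
    and letters: "w \<in> {U, D} \<Longrightarrow> set w \<subseteq> \<Delta>"
    and nonempty: "w \<in> {U, D} \<Longrightarrow> w \<noteq> []"
    and incomparable: "\<not> sublist U D" "\<not> sublist D U"
    and possible: "w \<in> {U, D} \<Longrightarrow> \<P>(\<omega> in M. history (length w) \<omega> = w) > 0"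
begin

definition hit :: "'a list \<Rightarrow> bool" where
  "hit l \<longleftrightarrow> suffix U l \<or> suffix D l"

definition step :: "'a list \<Rightarrow> int" where
  "step l = of_bool (suffix U l) - of_bool (suffix D l)"

definition level :: "'a list \<Rightarrow> int" where
  "level l = (\<Sum>i=1..length l. step (take i l))"

text \<open>The word \<open>r\<close> is read in the context of \<open>w\<close> because the next
  pattern may overlap \<open>w\<close>. The index starts at 1 so that an occurrence completed by
  \<open>w\<close> itself is not counted; the empty context serves the first gap.\<close>

definition quiet :: "'a list \<Rightarrow> 'a list \<Rightarrow> bool" where
  "quiet w r \<longleftrightarrow> (\<forall>i\<in>{1..length r}. \<not> hit (w @ take i r))"

text \<open>This is \<open>g\<^sub>w n\<close> of the overview, the tail of the gap that follows an
  occurrence of \<open>w\<close>.\<close>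

definition quiet_prob :: "'a list \<Rightarrow> nat \<Rightarrow> real" where
  "quiet_prob w n = (\<Sum>r\<in>words \<Delta> n. of_bool (quiet w r) * path_prob p (last w) r)"

definition sign :: "'a list \<Rightarrow> int" where
  "sign w = (if w = U then 1 else - 1)"

lemma not_sublist: "v \<in> {U, D} \<Longrightarrow> w \<in> {U, D} \<Longrightarrow> sublist v w \<Longrightarrow> v = w"
  using incomparable by auto

text \<open>Of two suffixes of one word the shorter is a suffix of the longer, hence contained in
  it. So the two patterns never end together.\<close>

lemma suffix_unique: "v \<in> {U, D} \<Longrightarrow> w \<in> {U, D} \<Longrightarrow> suffix v l \<Longrightarrow> suffix w l \<Longrightarrow> v = w"
  using not_sublist suffix_same_cases suffix_imp_sublist by metis

lemma hit_iff: "hit l \<longleftrightarrow> (\<exists>w\<in>{U, D}. suffix w l)"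
  by (auto simp: hit_def)

lemma hit_Nil [simp]: "\<not> hit []"
  using nonempty by (auto simp: hit_def)

lemma U_neq_D: "U \<noteq> D"
  using incomparable by auto

lemma step_eq_sign: "w \<in> {U, D} \<Longrightarrow> suffix w l \<Longrightarrow> step l = sign w"
  using suffix_unique[of U D l] U_neq_D by (auto simp: step_def sign_def)

lemma step_eq_0: "\<not> hit l \<Longrightarrow> step l = 0"
  by (simp add: step_def hit_def)

text \<open>A pattern reaching back beyond an occurrence of \<open>w\<close> would contain \<open>w\<close>; so after an
  occurrence of \<open>w\<close> everything earlier can be forgotten.\<close>

lemma suffix_forget:
  assumes "v \<in> {U, D}" "w \<in> {U, D}" "suffix w l"
  shows "suffix v (l @ r) \<longleftrightarrow> suffix v (w @ r)"
proof -
  obtain l' where l: "l = l' @ w" using assms(3) by (auto simp: suffix_def)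
  have "suffix v (w @ r)" if "v = x @ w @ r" for x
  proof -
    have "sublist w v" unfolding that sublist_def by blast
    then have "v = w" using assms not_sublist by blast
    then have "r = []" using arg_cong[OF that, of length] by simp
    then show ?thesis using \<open>v = w\<close> by simp
  qed
  then show ?thesis
    unfolding l append.assoc by (auto simp: suffix_append)
qed

lemma hit_forget: "w \<in> {U, D} \<Longrightarrow> suffix w l \<Longrightarrow> hit (l @ r) \<longleftrightarrow> hit (w @ r)"
  using suffix_forget[of U w l r] suffix_forget[of D w l r] by (simp add: hit_def)

lemma step_forget: "w \<in> {U, D} \<Longrightarrow> suffix w l \<Longrightarrow> step (l @ r) = step (w @ r)"
  using suffix_forget[of U w l r] suffix_forget[of D w l r] by (simp add: step_def)

lemma level_Nil [simp]: "level [] = 0"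
  by (simp add: level_def)

lemma level_snoc: "level (l @ [y]) = level l + step (l @ [y])"
  by (simp add: level_def)

lemma level_append: "level (l @ r) = level l + (\<Sum>i=1..length r. step (l @ take i r))"
proof (induction r rule: rev_induct)
  case (snoc y r)
  have "level (l @ r @ [y]) = level (l @ r) + step (l @ r @ [y])"
    using level_snoc[of "l @ r" y] by simp
  then show ?case using snoc by simp
qed simp

lemma quiet_append: "quiet w (r @ r') \<Longrightarrow> quiet w r"
  unfolding quiet_def
proof
  fix i assume *: "\<forall>i\<in>{1..length (r @ r')}. \<not> hit (w @ take i (r @ r'))" and i: "i \<in> {1..length r}"
  then show "\<not> hit (w @ take i r)" using bspec[OF *, of i] by simp
qed

lemma not_quiet: "v \<in> {U, D} \<Longrightarrow> suffix v r \<Longrightarrow> \<not> quiet w r"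
proof
  assume *: "v \<in> {U, D}" "suffix v r" and "quiet w r"
  moreover have "length r \<ge> 1"
    using * nonempty suffix_bot.extremum_uniqueI by (cases r) auto
  ultimately have "\<not> hit (w @ r)" unfolding quiet_def by (metis atLeastAtMost_iff order_refl take_all)
  then show False
    using * suffix_appendI unfolding hit_iff by blast
qed

text \<open>Since \<open>w\<close> can open the chain, its internal transitions have positive
  probability; irreducibility leads to its first letter.\<close>

lemma reach_pattern:
  assumes "w \<in> {U, D}" "x \<in> \<Delta>"
  shows "\<exists>r. set r \<subseteq> \<Delta> \<and> path_prob p x r > 0 \<and> suffix w r"
proof -
  obtain u v where w: "w = u # v" using nonempty[OF assms(1)] by (cases w) auto
  have "\<P>(\<omega> in M. history (length w) \<omega> = w) = \<P>(\<omega> in M. history (Suc 0) \<omega> = [u]) * path_prob p u v"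
    using prob_history_append[of "[u]" "Suc 0" v "length v"] letters[OF assms(1)] by (auto simp: words_def w)
  with possible[OF assms(1)] have "0 < \<P>(\<omega> in M. history (Suc 0) \<omega> = [u]) * path_prob p u v" by simp
  moreover have "0 \<le> \<P>(\<omega> in M. history (Suc 0) \<omega> = [u])" by (rule measure_nonneg)
  ultimately have "path_prob p u v > 0" by (auto simp: zero_less_mult_iff)
  then show ?thesis
    using reach_word[OF fin stoch irr assms(2), of u v] letters[OF assms(1)] unfolding w by blast
qed

lemma last_pattern: "w \<in> {U, D} \<Longrightarrow> last w \<in> \<Delta>"
  using letters nonempty by (meson last_in_set subsetD)

text \<open>From every letter the chain can run through \<open>U\<close>, and this ends a quiet
  stretch; in other words, the gap after \<open>w\<close> has finite mean.\<close>

lemma summable_quiet_prob: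
  assumes "w \<in> {U, D}"
  shows "summable (quiet_prob w)"
  unfolding quiet_prob_def
proof (rule summable_avoidance[OF fin stoch last_pattern[OF assms] quiet_append])
  fix y assume "y \<in> \<Delta>"
  with reach_pattern[of U y] obtain r where "set r \<subseteq> \<Delta>" "path_prob p y r > 0" "suffix U r" by auto
  moreover have "suffix U (l @ r)" for l
    using \<open>suffix U r\<close> by (rule suffix_appendI)
  ultimately show "\<exists>r. set r \<subseteq> \<Delta> \<and> path_prob p y r > 0 \<and>
      (\<forall>l. set l \<subseteq> \<Delta> \<longrightarrow> last (last w # l) = y \<longrightarrow> \<not> quiet w (l @ r))"
    using not_quiet[of U] by blast
qed

lemma summable_quiet:
  "summable (\<lambda>n. \<P>(\<omega> in M. quiet [] (history n \<omega>)))"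
proof (rule summable_prob_history[OF quiet_append])
  fix y assume "y \<in> \<Delta>"
  with reach_pattern[of U y] obtain r where "set r \<subseteq> \<Delta>" "path_prob p y r > 0" "suffix U r" by auto
  moreover have "suffix U (l @ r)" for l
    using \<open>suffix U r\<close> by (rule suffix_appendI)
  ultimately show "\<exists>r. set r \<subseteq> \<Delta> \<and> path_prob p y r > 0 \<and>
      (\<forall>l. set l \<subseteq> \<Delta> \<longrightarrow> l \<noteq> [] \<longrightarrow> last l = y \<longrightarrow> \<not> quiet [] (l @ r))"
    using not_quiet[of U] by blast
qed

lemma quiet_history: "quiet [] (history n \<omega>) \<longleftrightarrow> (\<forall>i\<le>n. \<not> hit (history i \<omega>))"
proof -
  have "quiet [] (history n \<omega>) \<longleftrightarrow> (\<forall>i\<in>{1..n}. \<not> hit (history i \<omega>))"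
    by (simp add: quiet_def)
  moreover have "{..n} = insert 0 {1..n}" by auto
  ultimately show ?thesis by (metis atMost_iff history_0 hit_Nil insert_iff)
qed

text \<open>The renewal property: \<open>L\<close> may constrain the past in any way, yet the future
  factor depends on \<open>w\<close> alone, because \<open>hit_forget\<close> replaces the past by
  \<open>w\<close> and both end in the same letter. At time 0 no pattern has ended and both sides
  are 0.\<close>

lemma prob_quiet_after:
  assumes "w \<in> {U, D}"
  shows "\<P>(\<omega> in M. (L (history n \<omega>) \<and> suffix w (history n \<omega>)) \<and> (\<forall>i\<in>{n<..n+m}. \<not> hit (history i \<omega>)))
    = \<P>(\<omega> in M. L (history n \<omega>) \<and> suffix w (history n \<omega>)) * quiet_prob w m"
proof (cases "n = 0")
  case False
  define Q where "Q l \<longleftrightarrow> (L (take n l) \<and> suffix w (take n l)) \<and> (\<forall>i\<in>{n<..n+m}. \<not> hit (take i l))" for l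
  have *: "of_bool (Q (l @ r)) * path_prob p (last l) r
      = of_bool (L l \<and> suffix w l) * (of_bool (quiet w r) * path_prob p (last w) r)"
    if "l \<in> words \<Delta> n" "r \<in> words \<Delta> m" for l r
  proof (cases "suffix w l")
    case True
    then have "last l = last w"
      using nonempty[OF assms] by (auto simp: suffix_def)
    moreover have "(\<forall>i\<in>{n<..n+m}. \<not> hit (take i (l @ r))) \<longleftrightarrow> quiet w r"
    proof -
      have image: "{n<..n+m} = (\<lambda>i. n + i) ` {1..m}"
        by (auto simp: image_iff intro!: bexI[of _ "_ - n"])
      have "(\<forall>i\<in>{n<..n+m}. \<not> hit (take i (l @ r))) \<longleftrightarrow> (\<forall>i\<in>{1..m}. \<not> hit (take (n + i) (l @ r)))"
        unfolding image by blast
      also have "\<dots> \<longleftrightarrow> quiet w r"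
        using that hit_forget[OF assms True] by (simp add: quiet_def words_def)
      finally show ?thesis .
    qed
    ultimately show ?thesis
      using that by (simp add: Q_def words_def)
  qed (use that in \<open>simp add: Q_def words_def\<close>)
  have "\<P>(\<omega> in M. (L (history n \<omega>) \<and> suffix w (history n \<omega>)) \<and> (\<forall>i\<in>{n<..n+m}. \<not> hit (history i \<omega>)))
      = \<P>(\<omega> in M. Q (history (n + m) \<omega>))"
    by (intro arg_cong[where f = prob]) (auto simp: Q_def min_absorb1)
  also have "\<dots> = (\<Sum>l\<in>words \<Delta> n. \<P>(\<omega> in M. history n \<omega> = l) * (of_bool (L l \<and> suffix w l) * quiet_prob w m))"
    using False * unfolding quiet_prob_def
    by (subst prob_history_add) (auto simp: sum_distrib_left intro!: sum.cong)
  also have "\<dots> = \<P>(\<omega> in M. L (history n \<omega>) \<and> suffix w (history n \<omega>)) * quiet_prob w m"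
    unfolding prob_history[of "\<lambda>l. L l \<and> suffix w l" n] by (simp add: sum_distrib_left mult_ac)
  finally show ?thesis .
qed (use nonempty[OF assms] in simp)

section \<open>The score in the strip\<close>

text \<open>The counterpart for words of the event that the exit time exceeds
  \<open>length l\<close>. Only the two boundary levels are excluded, as in the exit time
  itself.\<close>

definition in_strip :: "int \<Rightarrow> int \<Rightarrow> 'a list \<Rightarrow> bool" where
  "in_strip A B l \<longleftrightarrow> (\<forall>i\<in>{1..length l}. level (take i l) \<noteq> A \<and> level (take i l) \<noteq> - B)"

lemma in_strip_Nil [simp]: "in_strip A B []"
  by (simp add: in_strip_def)

lemma in_strip_snoc:
  "in_strip A B (l @ [y]) \<longleftrightarrow> in_strip A B l \<and> level (l @ [y]) \<noteq> A \<and> level (l @ [y]) \<noteq> - B"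
proof -
  have "{1..length (l @ [y])} = insert (Suc (length l)) {1..length l}" by auto
  then show ?thesis unfolding in_strip_def by auto
qed

lemma in_strip_append: "in_strip A B (l @ r) \<Longrightarrow> in_strip A B l"
proof (induction r rule: rev_induct)
  case (snoc y r)
  then show ?case using in_strip_snoc[of A B "l @ r" y] by simp
qed simp

lemma step_range: "step l \<in> {-1, 0, 1}"
  by (auto simp: step_def)

text \<open>The level starts at 0 and moves by at most one, so it cannot jump over a
  boundary.\<close>

lemma level_in_strip:
  assumes "A > 0" "B > 0"
  shows "in_strip A B l \<Longrightarrow> - B < level l \<and> level l < A"
proof (induction l rule: rev_induct)
  case (snoc y l)
  then have "- B < level l \<and> level l < A" "level (l @ [y]) \<noteq> A" "level (l @ [y]) \<noteq> - B"
    by (auto simp: in_strip_snoc)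
  then show ?case using step_range[of "l @ [y]"] by (auto simp: level_snoc)
qed (use assms in simp)

text \<open>If with positive probability the next pattern after \<open>w\<close> is \<open>w\<close> again, then \<open>A + B\<close>
  such rounds in a row carry the level from any point of the strip out of it.\<close>

lemma summable_in_strip:
  assumes AB: "A > 0" "B > 0" and w: "w \<in> {U, D}"
    and v: "set v \<subseteq> \<Delta>" "path_prob p (last w) v > 0" "v \<noteq> []" "quiet w (butlast v)" "suffix w (w @ v)"
  shows "summable (\<lambda>n. \<P>(\<omega> in M. in_strip A B (history n \<omega>)))"
proof (rule summable_prob_history[OF in_strip_append])
  \<comment> \<open>While \<open>v\<close> is read after \<open>w\<close>, the only pattern that
    ends is \<open>w\<close>, at the last letter. The condition is \<open>suffix w (w @ v)\<close>
    because this new occurrence may overlap the old one.\<close>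
  have round: "level (l @ v) = level l + sign w" if l: "suffix w l" for l
  proof -
    have "(\<Sum>i=1..length v. step (l @ take i v)) = (\<Sum>i=1..length v. if i = length v then sign w else 0)"
    proof (intro sum.cong refl)
      fix i assume i: "i \<in> {1..length v}"
      show "step (l @ take i v) = (if i = length v then sign w else 0)"
      proof (cases "i = length v")
        case True
        then show ?thesis using step_forget[OF w l] step_eq_sign[OF w v(5)] by simp
      next
        case False
        then have "take i v = take i (butlast v)" "i \<in> {1..length (butlast v)}"
          using i by (auto simp: take_butlast)
        then have "\<not> hit (w @ take i v)" using v(4) by (simp add: quiet_def)
        then show ?thesis using False step_forget[OF w l] step_eq_0 by simp
      qed
    qed
    also have "\<dots> = sign w" using v(3) by (simp add: Suc_le_eq)
    finally show ?thesis by (simp add: level_append)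
  qed
  define rounds where "rounds k = concat (replicate k v)" for k
  have level: "level (l @ rounds k) = level l + int k * sign w" if "suffix w l" for k l
    using that
  proof (induction k arbitrary: l)
    case (Suc k)
    have "suffix w (l @ v)" using suffix_forget[OF w w Suc.prems] v(5) by blast
    then show ?case using Suc.IH[of "l @ v"] round[OF Suc.prems] by (simp add: rounds_def algebra_simps)
  qed (simp add: rounds_def)
  have last: "last (w @ v) = last w"
    using v(5) nonempty[OF w] by (metis last_appendR suffix_def)
  have pos: "path_prob p (last w) (rounds k) > 0" for k
    by (induction k) (use v last in \<open>auto simp: rounds_def path_prob_append\<close>)
  fix y assume "y \<in> \<Delta>"
  \<comment> \<open>The rounds must start from an occurrence of \<open>w\<close>, which
    \<open>r\<close> provides from any letter.\<close>
  with reach_pattern[OF w this] obtain r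
    where r: "set r \<subseteq> \<Delta>" "path_prob p y r > 0" "suffix w r" by auto
  define k where "k = nat (A + B)"
  have "\<not> in_strip A B (l @ r @ rounds k)" for l
  proof
    assume *: "in_strip A B (l @ r @ rounds k)"
    then have "in_strip A B (l @ r)" using in_strip_append[of A B "l @ r"] by simp
    moreover have "level (l @ r @ rounds k) = level (l @ r) + int k * sign w"
      using level[of "l @ r" k] suffix_appendI[OF r(3)] by simp
    ultimately show False
      using level_in_strip[OF AB *] level_in_strip[OF AB, of "l @ r"] AB by (auto simp: k_def sign_def split: if_splits)
  qed
  moreover have "last (y # r) = last w"
    using r(3) nonempty[OF w] by (auto simp: suffix_def)
  then have "path_prob p y (r @ rounds k) > 0"
    using r pos by (simp add: path_prob_append)
  moreover have "set (rounds k) \<subseteq> \<Delta>"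
    using v(1) by (auto simp: rounds_def)
  ultimately show "\<exists>r. set r \<subseteq> \<Delta> \<and> path_prob p y r > 0 \<and>
      (\<forall>l. set l \<subseteq> \<Delta> \<longrightarrow> l \<noteq> [] \<longrightarrow> last l = y \<longrightarrow> \<not> in_strip A B (l @ r))"
    using r(1) by (intro exI[of _ "r @ rounds k"]) auto
qed

text \<open>This is \<open>v\<^sub>w n\<close> of the overview.\<close>

definition visit_prob :: "int \<Rightarrow> int \<Rightarrow> 'a list \<Rightarrow> nat \<Rightarrow> real" where
  "visit_prob A B w n = \<P>(\<omega> in M. in_strip A B (history n \<omega>) \<and> suffix w (history n \<omega>))"

lemma visit_prob_nonneg: "0 \<le> visit_prob A B w n"
  by (simp add: visit_prob_def)

lemma quiet_prob_nonneg: "w \<in> {U, D} \<Longrightarrow> 0 \<le> quiet_prob w n"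
  unfolding quiet_prob_def using last_pattern[of w]
  by (intro sum_nonneg mult_nonneg_nonneg path_prob_nonneg[OF fin stoch]) (auto simp: words_def)

text \<open>The decomposition at the last occurrence, for a single word. Without occurrences the
  level is 0, inside the strip; otherwise there is exactly one last pair \<open>w\<close>,
  \<open>j\<close>, and the level is frozen after \<open>j\<close>, so staying in the strip is
  decided at \<open>j\<close>.\<close>

lemma in_strip_last_hit:
  assumes "A > 0" "B > 0"
  shows "(of_bool (in_strip A B l) :: real) = of_bool (quiet [] l) +
    (\<Sum>w\<in>{U, D}. \<Sum>j\<le>length l. of_bool ((in_strip A B (take j l) \<and> suffix w (take j l)) \<and>
      (\<forall>i\<in>{j<..length l}. \<not> hit (take i l))))"
proof (induction l rule: rev_induct)
  case Nil
  show ?case using nonempty by (simp add: quiet_def)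
next
  case (snoc y l)
  let ?E = "\<lambda>l w j. (in_strip A B (take j l) \<and> suffix w (take j l)) \<and> (\<forall>i\<in>{j<..length l}. \<not> hit (take i l))"
  have split: "{j<..length (l @ [y])} = insert (Suc (length l)) {j<..length l}" if "j \<le> length l" for j
    using that by auto
  have E: "?E (l @ [y]) w j \<longleftrightarrow> ?E l w j \<and> \<not> hit (l @ [y])" if "j \<le> length l" for w j
    unfolding split[OF that] using that by auto
  have quiet: "quiet [] (l @ [y]) \<longleftrightarrow> quiet [] l \<and> \<not> hit (l @ [y])"
  proof -
    have "{1..length (l @ [y])} = insert (Suc (length l)) {1..length l}" by auto
    then show ?thesis unfolding quiet_def by auto
  qed
  have "(\<Sum>w\<in>{U, D}. \<Sum>j\<le>length (l @ [y]). of_bool (?E (l @ [y]) w j) :: real)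
      = (\<Sum>w\<in>{U, D}. (\<Sum>j\<le>length l. of_bool (?E l w j \<and> \<not> hit (l @ [y])))
          + of_bool (in_strip A B (l @ [y]) \<and> suffix w (l @ [y])))"
    using E by (intro sum.cong refl) simp
  \<comment> \<open>If a pattern ends at \<open>y\<close>, all old terms vanish and exactly one new
    term can remain. Otherwise the level is unchanged and the induction hypothesis carries
    over.\<close>
  also have "of_bool (quiet [] (l @ [y])) + \<dots> = of_bool (in_strip A B (l @ [y]))"
  proof (cases "hit (l @ [y])")
    case True
    then have "suffix U (l @ [y]) \<noteq> suffix D (l @ [y])"
      using suffix_unique[of U D "l @ [y]"] U_neq_D by (auto simp: hit_def simp del: suffix_snoc)
    then show ?thesis using True U_neq_D by (auto simp: quiet)
  next
    case False
    then have "level (l @ [y]) = level l" by (simp add: level_snoc step_eq_0)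
    then have "in_strip A B (l @ [y]) \<longleftrightarrow> in_strip A B l"
      using level_in_strip[OF assms, of l] by (auto simp: in_strip_snoc)
    moreover have "\<not> suffix U (l @ [y])" "\<not> suffix D (l @ [y])"
      using False by (auto simp: hit_def)
    ultimately show ?thesis using snoc False U_neq_D by (simp add: quiet)
  qed
  finally show ?case by simp
qed

text \<open>Each term of the decomposition factors by \<open>prob_quiet_after\<close>, so averaging
  over words gives a convolution in \<open>j\<close>.\<close>

lemma prob_in_strip:
  assumes "A > 0" "B > 0"
  shows "\<P>(\<omega> in M. in_strip A B (history n \<omega>)) = \<P>(\<omega> in M. quiet [] (history n \<omega>)) +
    (\<Sum>w\<in>{U, D}. \<Sum>j\<le>n. visit_prob A B w j * quiet_prob w (n - j))"
proof -
  let ?E = "\<lambda>l w j. (in_strip A B (take j l) \<and> suffix w (take j l)) \<and> (\<forall>i\<in>{j<..n}. \<not> hit (take i l))"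
  have E: "(\<Sum>l\<in>words \<Delta> n. of_bool (?E l w j) * \<P>(\<omega> in M. history n \<omega> = l)) = visit_prob A B w j * quiet_prob w (n - j)"
    if "w \<in> {U, D}" "j \<le> n" for w j
  proof -
    have "(\<Sum>l\<in>words \<Delta> n. of_bool (?E l w j) * \<P>(\<omega> in M. history n \<omega> = l)) = \<P>(\<omega> in M. ?E (history n \<omega>) w j)"
      by (rule prob_history[symmetric])
    also have "\<dots> = \<P>(\<omega> in M. (in_strip A B (history j \<omega>) \<and> suffix w (history j \<omega>)) \<and>
        (\<forall>i\<in>{j<..j + (n - j)}. \<not> hit (history i \<omega>)))"
      using that by (intro arg_cong[where f = prob] Collect_cong conj_cong refl) (auto simp: min_def)
    also have "\<dots> = visit_prob A B w j * quiet_prob w (n - j)"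
      unfolding visit_prob_def by (rule prob_quiet_after[OF that(1)])
    finally show ?thesis .
  qed
  have "\<P>(\<omega> in M. in_strip A B (history n \<omega>)) =
      (\<Sum>l\<in>words \<Delta> n. (of_bool (quiet [] l) + (\<Sum>w\<in>{U, D}. \<Sum>j\<le>n. of_bool (?E l w j))) * \<P>(\<omega> in M. history n \<omega> = l))"
    unfolding prob_history[of "in_strip A B"]
    by (intro sum.cong refl arg_cong2[where f = "(*)"], subst in_strip_last_hit[OF assms]) (auto simp: words_def)
  also have "\<dots> = (\<Sum>l\<in>words \<Delta> n. of_bool (quiet [] l) * \<P>(\<omega> in M. history n \<omega> = l)) +
      (\<Sum>l\<in>words \<Delta> n. \<Sum>w\<in>{U, D}. \<Sum>j\<le>n. of_bool (?E l w j) * \<P>(\<omega> in M. history n \<omega> = l))"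
    unfolding distrib_right sum.distrib sum_distrib_right ..
  also have "(\<Sum>l\<in>words \<Delta> n. \<Sum>w\<in>{U, D}. \<Sum>j\<le>n. of_bool (?E l w j) * \<P>(\<omega> in M. history n \<omega> = l))
      = (\<Sum>w\<in>{U, D}. \<Sum>l\<in>words \<Delta> n. \<Sum>j\<le>n. of_bool (?E l w j) * \<P>(\<omega> in M. history n \<omega> = l))"
    by (rule sum.swap)
  also have "\<dots> = (\<Sum>w\<in>{U, D}. \<Sum>j\<le>n. \<Sum>l\<in>words \<Delta> n. of_bool (?E l w j) * \<P>(\<omega> in M. history n \<omega> = l))"
    by (intro sum.cong refl sum.swap)
  also have "\<dots> = (\<Sum>w\<in>{U, D}. \<Sum>j\<le>n. visit_prob A B w j * quiet_prob w (n - j))"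
    by (intro sum.cong refl E) auto
  finally show ?thesis
    unfolding prob_history[of "quiet []"] .
qed

lemma summable_visit_prob:
  assumes "summable (\<lambda>n. \<P>(\<omega> in M. in_strip A B (history n \<omega>)))"
  shows "summable (visit_prob A B w)"
proof (rule summable_comparison_test'[OF assms])
  show "norm (visit_prob A B w n) \<le> \<P>(\<omega> in M. in_strip A B (history n \<omega>))" for n
    unfolding visit_prob_def by (auto intro!: finite_measure_mono)
qed

text \<open>Summation over \<open>n\<close> turns the convolutions into products, as Cauchy products
  of summable nonnegative sequences.\<close>

lemma sums_in_strip:
  assumes "A > 0" "B > 0" and "summable (\<lambda>n. \<P>(\<omega> in M. in_strip A B (history n \<omega>)))"
  shows "(\<lambda>n. \<P>(\<omega> in M. in_strip A B (history n \<omega>))) sums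
    ((\<Sum>n. \<P>(\<omega> in M. quiet [] (history n \<omega>))) +
     (\<Sum>w\<in>{U, D}. suminf (visit_prob A B w) * suminf (quiet_prob w)))"
  unfolding prob_in_strip[OF assms(1,2)]
proof (intro sums_add sums_sum Cauchy_product_sums)
  show "(\<lambda>n. \<P>(\<omega> in M. quiet [] (history n \<omega>))) sums (\<Sum>n. \<P>(\<omega> in M. quiet [] (history n \<omega>)))"
    by (intro summable_sums summable_quiet)
  show "summable (\<lambda>n. norm (visit_prob A B w n))" for w
    using summable_visit_prob[OF assms(3)] visit_prob_nonneg by simp
  show "summable (\<lambda>n. norm (quiet_prob w n))" if "w \<in> {U, D}" for w
    using summable_quiet_prob[OF that] quiet_prob_nonneg[OF that] by simp
qed

end

section \<open>Occurrence times, signs and exit times in terms of histories\<close>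

lemma suffix_iff_drop: "suffix w l \<longleftrightarrow> length w \<le> length l \<and> drop (length l - length w) l = w"
  by (auto simp: suffix_def) (metis append_take_drop_id)

context two_patterns
begin

lemma word_ind_history:
  assumes "w \<in> {U, D}"
  shows "word_ind Y w n \<omega> = of_bool (suffix w (history n \<omega>))"
proof -
  have "drop (n - length w) (history n \<omega>) = w \<longleftrightarrow> (\<forall>j<length w. Y (n - length w + 1 + j) \<omega> = w ! j)"
    if "length w \<le> n"
    using that by (auto simp: list_eq_iff_nth_eq nth_history)
  then show ?thesis
    unfolding word_ind_def suffix_iff_drop by auto
qed

lemma occurrence_iff_hit: "word_ind Y U n \<omega> = 1 \<or> word_ind Y D n \<omega> = 1 \<longleftrightarrow> hit (history n \<omega>)"
  by (auto simp: word_ind_history hit_def)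

lemma level_history: "level (history n \<omega>) = (\<Sum>i=1..n. step (history i \<omega>))"
  by (simp add: level_def)

lemma score_eq_level: "score Y U D n \<omega> = level (history n \<omega>)"
  by (simp add: score_def level_history word_ind_history step_def)

lemma in_strip_history:
  "in_strip A B (history n \<omega>) \<longleftrightarrow> (\<forall>i\<in>{1..n}. level (history i \<omega>) \<noteq> A \<and> level (history i \<omega>) \<noteq> - B)"
  by (simp add: in_strip_def)

lemma less_exit_time_iff:
  "enat n < exit_time (score Y U D) A B \<omega> \<longleftrightarrow> in_strip A B (history n \<omega>)"
  unfolding exit_time_def less_Inf_enat_iff score_eq_level in_strip_history by auto

lemma occ_Suc_eq_iff:
  assumes "occ_time Y U D k \<omega> = enat m"
  shows "occ_time Y U D (Suc k) \<omega> = enat n \<longleftrightarrow>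
    m < n \<and> hit (history n \<omega>) \<and> (\<forall>i\<in>{m<..<n}. \<not> hit (history i \<omega>))"
  unfolding occ_time.simps occurrence_iff_hit Inf_enat_eq_iff assms by auto

lemma less_occ_Suc_iff:
  assumes "occ_time Y U D k \<omega> = enat m"
  shows "enat n < occ_time Y U D (Suc k) \<omega> \<longleftrightarrow> (\<forall>i\<in>{m<..n}. \<not> hit (history i \<omega>))"
  unfolding occ_time.simps occurrence_iff_hit less_Inf_enat_iff assms by auto

lemma occ_Suc_infinite:
  assumes "occ_time Y U D k \<omega> = \<infinity>"
  shows "occ_time Y U D (Suc k) \<omega> = \<infinity>"
  using assms by (simp add: top_enat_def[symmetric])

text \<open>The clock inverse to \<open>occ_time\<close>: it converts a time of the chain into an
  index of the sign sequence.\<close>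

definition hits :: "nat \<Rightarrow> 'w \<Rightarrow> nat" where
  "hits n \<omega> = card {i\<in>{1..n}. hit (history i \<omega>)}"

lemma hits_0 [simp]: "hits 0 \<omega> = 0"
  by (simp add: hits_def)

lemma hits_Suc: "hits (Suc n) \<omega> = hits n \<omega> + of_bool (hit (history (Suc n) \<omega>))"
proof -
  have "{i\<in>{1..Suc n}. hit (history i \<omega>)} =
      (if hit (history (Suc n) \<omega>) then insert (Suc n) else id) {i\<in>{1..n}. hit (history i \<omega>)}"
    by (auto simp: le_Suc_eq)
  then show ?thesis by (simp add: hits_def)
qed

text \<open>Every hit advances the occurrence index by one. The value 0 of \<open>occ_time\<close>
  at index 0 covers the case that nothing has occurred yet.\<close>

lemma occ_time_hits:
  "\<exists>m\<le>n. occ_time Y U D (hits n \<omega>) \<omega> = enat m \<and> (\<forall>i\<in>{m<..n}. \<not> hit (history i \<omega>))"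
proof (induction n)
  case (Suc n)
  then obtain m where m: "m \<le> n" "occ_time Y U D (hits n \<omega>) \<omega> = enat m" "\<forall>i\<in>{m<..n}. \<not> hit (history i \<omega>)"
    by auto
  show ?case
  proof (cases "hit (history (Suc n) \<omega>)")
    case True
    then have "occ_time Y U D (Suc (hits n \<omega>)) \<omega> = enat (Suc n)"
      using m by (subst occ_Suc_eq_iff) auto
    then show ?thesis using True by (auto simp: hits_Suc simp del: occ_time.simps)
  next
    case False
    then show ?thesis using m by (auto simp: hits_Suc le_Suc_eq intro!: exI[of _ m])
  qed
qed (auto simp: zero_enat_def)

lemma occ_time_hit: "hit (history n \<omega>) \<Longrightarrow> occ_time Y U D (hits n \<omega>) \<omega> = enat n"
  using occ_time_hits[of n \<omega>] by (metis greaterThanAtMost_iff le_neq_implies_less order_refl)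

lemma occ_time_le_hits: "k \<le> hits n \<omega> \<Longrightarrow> \<exists>m\<le>n. occ_time Y U D k \<omega> = enat m"
proof (induction n)
  case (Suc n)
  show ?case
  proof (cases "k \<le> hits n \<omega>")
    case False
    then have "k = hits (Suc n) \<omega>" using Suc.prems by (cases "hit (history (Suc n) \<omega>)") (auto simp: hits_Suc)
    then show ?thesis using occ_time_hits[of "Suc n" \<omega>] by blast
  qed (use Suc.IH in \<open>auto intro: le_SucI\<close>)
qed (auto simp: zero_enat_def)

text \<open>The time change between score and signs: between successive occurrences the count and
  the level are frozen, and at an occurrence the step is the sign.\<close>

lemma hits_occ_time:
  assumes "occ_time Y U D k \<omega> = enat n"
  shows "hits n \<omega> = k \<and> (k > 0 \<longrightarrow> hit (history n \<omega>)) \<and> (\<Sum>j=1..k. occ_sign Y U D j \<omega>) = level (history n \<omega>)"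
  using assms
proof (induction k arbitrary: n)
  case (Suc k)
  have "occ_time Y U D k \<omega> \<noteq> \<infinity>" using Suc.prems occ_Suc_infinite by fastforce
  then obtain m where m: "occ_time Y U D k \<omega> = enat m" by auto
  note IH = Suc.IH[OF m]
  have n: "m < n" "hit (history n \<omega>)" "\<forall>i\<in>{m<..<n}. \<not> hit (history i \<omega>)"
    using Suc.prems unfolding occ_Suc_eq_iff[OF m] by auto
  have frozen: "m \<le> i \<Longrightarrow> i < n \<Longrightarrow> hits i \<omega> = hits m \<omega> \<and> level (history i \<omega>) = level (history m \<omega>)" for i
  proof (induction i rule: dec_induct)
    case (step i)
    then have "\<not> hit (history (Suc i) \<omega>)" using n(3) by auto
    then show ?case using step by (auto simp: hits_Suc level_history step_eq_0)
  qed simp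
  obtain n' where n': "n = Suc n'" "m \<le> n'" using n(1) by (cases n) auto
  have "hits n \<omega> = Suc k"
    using IH frozen[of n'] n n' by (simp add: hits_Suc)
  moreover have "level (history n \<omega>) = level (history m \<omega>) + step (history n \<omega>)"
    using frozen[of n'] n' by (simp add: level_history)
  moreover have "occ_sign Y U D (Suc k) \<omega> = step (history n \<omega>)"
    using Suc.prems n(2) suffix_unique[of U D "history n \<omega>"] U_neq_D
    by (auto simp: occ_sign_def word_ind_history step_def hit_def simp del: occ_time.simps)
  ultimately show ?case using IH n(2) by simp
qed (simp add: zero_enat_def)

text \<open>The level changes only at hits and only by one, so exit happens at a hit and from the
  level next to the boundary. That last level later determines the difference of the visit
  counts.\<close>

lemma exit_time_finite:
  assumes "A > 0" "B > 0" and exit: "exit_time (score Y U D) A B \<omega> = enat n"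
  shows "hit (history n \<omega>)" and "n > 0"
    and "\<And>j. in_strip A B (history j \<omega>) \<longleftrightarrow> j < n"
    and "level (history n \<omega>) = A \<and> level (history (n - 1) \<omega>) = A - 1 \<or>
         level (history n \<omega>) = - B \<and> level (history (n - 1) \<omega>) = 1 - B"
proof -
  show j: "in_strip A B (history j \<omega>) \<longleftrightarrow> j < n" for j
    using less_exit_time_iff[of j A B \<omega>] exit by simp
  show "n > 0" using j[of 0] by simp
  then obtain m where m: "n = Suc m" by (cases n) auto
  have lev: "level (history n \<omega>) = A \<or> level (history n \<omega>) = - B"
    using exit unfolding exit_time_def Inf_enat_eq_iff score_eq_level by auto
  have strip: "- B < level (history m \<omega>) \<and> level (history m \<omega>) < A"
    using level_in_strip[OF assms(1,2)] j[of m] m by auto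
  have step: "level (history n \<omega>) = level (history m \<omega>) + step (history n \<omega>)"
    by (simp add: m level_history)
  show "hit (history n \<omega>)"
    using lev strip step step_eq_0 by fastforce
  show "level (history n \<omega>) = A \<and> level (history (n - 1) \<omega>) = A - 1 \<or>
         level (history n \<omega>) = - B \<and> level (history (n - 1) \<omega>) = 1 - B"
    using lev strip step step_range[of "history n \<omega>"] by (auto simp: m)
qed

text \<open>The sign sums are the score at occurrence times, and exit is itself an occurrence. An
  earlier exit of the sign sums would be an earlier exit of the score.\<close>

lemma exit_time_signs:
  assumes "A > 0" "B > 0" and exit: "exit_time (score Y U D) A B \<omega> = enat n"
  shows "exit_time (\<lambda>k \<omega>. \<Sum>j=1..k. occ_sign Y U D j \<omega>) A B \<omega> = enat (hits n \<omega>)"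
  unfolding exit_time_def Inf_enat_eq_iff
proof (intro conjI allI impI notI)
  note n = exit_time_finite[OF assms]
  have occ: "occ_time Y U D (hits n \<omega>) \<omega> = enat n" by (rule occ_time_hit[OF n(1)])
  then show "1 \<le> hits n \<omega>" using n(2) by (cases "hits n \<omega>") (auto simp: zero_enat_def)
  show "(\<Sum>j=1..hits n \<omega>. occ_sign Y U D j \<omega>) = A \<or> (\<Sum>j=1..hits n \<omega>. occ_sign Y U D j \<omega>) = - B"
    using hits_occ_time[OF occ] n(4) by auto
  fix k assume k: "k < hits n \<omega>" and
    *: "1 \<le> k \<and> ((\<Sum>j=1..k. occ_sign Y U D j \<omega>) = A \<or> (\<Sum>j=1..k. occ_sign Y U D j \<omega>) = - B)"
  obtain m where m: "m \<le> n" "occ_time Y U D k \<omega> = enat m"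
    using occ_time_le_hits[of k n \<omega>] k by auto
  have "m < n" using m hits_occ_time[OF m(2)] k by (cases "m = n") auto
  moreover have "m > 0" using * hits_occ_time[OF m(2)] by (cases m) auto
  moreover have "level (history m \<omega>) = A \<or> level (history m \<omega>) = - B"
    using * hits_occ_time[OF m(2)] by auto
  ultimately show False
    using n(3)[of m] by (auto simp: in_strip_history)
qed

lemma visits_before_exit:
  assumes "A > 0" "B > 0" and exit: "exit_time (score Y U D) A B \<omega> = enat n"
  shows "(\<Sum>j. of_bool (in_strip A B (history j \<omega>) \<and> suffix w (history j \<omega>)) :: ennreal)
    = of_nat (card {j\<in>{..<n}. suffix w (history j \<omega>)})"
proof -
  note n = exit_time_finite[OF assms]
  have "(\<Sum>j. of_bool (in_strip A B (history j \<omega>) \<and> suffix w (history j \<omega>)) :: ennreal)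
      = (\<Sum>j<n. of_bool (suffix w (history j \<omega>)))"
    by (subst suminf_finite[of "{..<n}"]) (auto simp: n(3))
  also have "\<dots> = of_nat (card ({..<n} \<inter> {j. suffix w (history j \<omega>)}))"
    by simp
  also have "{..<n} \<inter> {j. suffix w (history j \<omega>)} = {j\<in>{..<n}. suffix w (history j \<omega>)}"
    by auto
  finally show ?thesis .
qed

text \<open>No occurrence belongs to both patterns. Taken one step before exit, the sum of the
  counts becomes \<open>T - 1\<close> and their difference the level from which the strip is
  left.\<close>

lemma card_visits:
  "card {j\<in>{..n}. suffix U (history j \<omega>)} + card {j\<in>{..n}. suffix D (history j \<omega>)} = hits n \<omega>"
  "int (card {j\<in>{..n}. suffix U (history j \<omega>)}) - int (card {j\<in>{..n}. suffix D (history j \<omega>)}) = level (history n \<omega>)"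
proof -
  have card: "card {j\<in>{..n}. suffix w (history j \<omega>)} = (\<Sum>j=1..n. of_bool (suffix w (history j \<omega>)))"
    if "w \<in> {U, D}" for w
  proof -
    have "{j\<in>{..n}. suffix w (history j \<omega>)} = {1..n} \<inter> {j. suffix w (history j \<omega>)}"
      using nonempty[OF that] by (auto simp: Suc_le_eq intro!: gr0I)
    then show ?thesis by (simp add: sum_of_bool_eq)
  qed
  have "hits n \<omega> = (\<Sum>j=1..n. of_bool (hit (history j \<omega>)))"
    unfolding hits_def by (simp add: sum_of_bool_eq Int_def)
  also have "\<dots> = (\<Sum>j=1..n. of_bool (suffix U (history j \<omega>)) + of_bool (suffix D (history j \<omega>)))"
    using suffix_unique[of U D] U_neq_D by (intro sum.cong refl) (auto simp: hit_def)
  finally show "card {j\<in>{..n}. suffix U (history j \<omega>)} + card {j\<in>{..n}. suffix D (history j \<omega>)} = hits n \<omega>"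
    using card[of U] card[of D] by (simp add: sum.distrib)
  show "int (card {j\<in>{..n}. suffix U (history j \<omega>)}) - int (card {j\<in>{..n}. suffix D (history j \<omega>)}) = level (history n \<omega>)"
    using card[of U] card[of D] by (simp add: level_history step_def sum_subtractf)
qed

section \<open>The first occurrence and the gap after it\<close>

definition first :: "'a list \<Rightarrow> nat \<Rightarrow> 'w \<Rightarrow> bool" where
  "first w n \<omega> \<longleftrightarrow> (\<forall>i<n. \<not> hit (history i \<omega>)) \<and> suffix w (history n \<omega>)"

lemma hit_pos: "hit (history n \<omega>) \<Longrightarrow> n > 0"
  by (cases n) auto

lemma occ_1_eq_iff: "occ_time Y U D 1 \<omega> = enat n \<longleftrightarrow> first U n \<omega> \<or> first D n \<omega>"
  using occ_Suc_eq_iff[of 0 \<omega> 0 n] hit_pos[of _ \<omega>] nonempty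
  by (auto simp: first_def hit_def[of "history n \<omega>"] zero_enat_def simp del: occ_time.simps(2))

lemma first_unique:
  assumes "v \<in> {U, D}" "w \<in> {U, D}" "first v m \<omega>" "first w n \<omega>"
  shows "m = n \<and> v = w"
proof -
  have "occ_time Y U D 1 \<omega> = enat m" "occ_time Y U D 1 \<omega> = enat n"
    using assms unfolding occ_1_eq_iff by auto
  then have "m = n" by simp
  then show ?thesis using assms suffix_unique[of v w "history n \<omega>"] by (simp add: first_def)
qed

lemma sign_eq_iff: "v \<in> {U, D} \<Longrightarrow> w \<in> {U, D} \<Longrightarrow> sign v = sign w \<longleftrightarrow> v = w"
  using U_neq_D by (auto simp: sign_def)

lemma occ_sign_eq_step:
  assumes "occ_time Y U D k \<omega> = enat n" "hit (history n \<omega>)"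
  shows "occ_sign Y U D k \<omega> = step (history n \<omega>)"
  using assms suffix_unique[of U D "history n \<omega>"] U_neq_D
  by (auto simp: occ_sign_def word_ind_history step_def hit_def)

lemma step_eq_sign_iff:
  assumes "w \<in> {U, D}"
  shows "step l = sign w \<longleftrightarrow> suffix w l"
proof
  assume *: "step l = sign w"
  then have "hit l" using step_eq_0[of l] by (auto simp: sign_def split: if_splits)
  then obtain v where "v \<in> {U, D}" "suffix v l" by (auto simp: hit_iff)
  then show "suffix w l" using * step_eq_sign[of v l] sign_eq_iff[of v w] assms by simp
qed (use assms step_eq_sign in blast)

lemma sign_1_iff:
  assumes "w \<in> {U, D}"
  shows "occ_sign Y U D 1 \<omega> = sign w \<longleftrightarrow> (\<exists>n. first w n \<omega>)"
proof (cases "occ_time Y U D 1 \<omega>")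
  case (enat n)
  then have n: "first U n \<omega> \<or> first D n \<omega>" using occ_1_eq_iff by simp
  then have "hit (history n \<omega>)" by (auto simp: hit_def first_def)
  then have "occ_sign Y U D 1 \<omega> = sign w \<longleftrightarrow> suffix w (history n \<omega>)"
    using occ_sign_eq_step[OF enat] step_eq_sign_iff[OF assms] by simp
  also have "\<dots> \<longleftrightarrow> (\<exists>n. first w n \<omega>)"
  proof
    assume "suffix w (history n \<omega>)"
    then show "\<exists>n. first w n \<omega>" using n unfolding first_def by blast
  next
    assume "\<exists>n. first w n \<omega>"
    then obtain k where k: "first w k \<omega>" by blast
    then have "k = n" using n first_unique[OF assms, of _ k \<omega> n] by blast
    then show "suffix w (history n \<omega>)" using k by (simp add: first_def)
  qed
  finally show ?thesis .
next
  \<comment> \<open>Without an occurrence the sign defaults to 0, which differs from both values of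
    \<open>sign\<close>.\<close>
  case infinity
  then show ?thesis
    using occ_1_eq_iff[of \<omega>] assms by (auto simp: occ_sign_def sign_def simp del: occ_time.simps)
qed

text \<open>The negated existential also covers an infinite first occurrence time: the gap is then
  \<open>\<infinity> - \<infinity>\<close>, which is \<open>\<infinity>\<close> in
  \<open>enat\<close>.\<close>

lemma less_gap_2_iff:
  "enat m < gap Y U D 2 \<omega> \<longleftrightarrow>
    \<not> (\<exists>n. (first U n \<omega> \<or> first D n \<omega>) \<and> (\<exists>i\<in>{n<..n+m}. hit (history i \<omega>)))"
proof (cases "occ_time Y U D 1 \<omega>")
  case (enat n)
  have "enat m < gap Y U D 2 \<omega> \<longleftrightarrow> enat (n + m) < occ_time Y U D (Suc 1) \<omega>"
    unfolding gap_def using enat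
    by (cases "occ_time Y U D (Suc 1) \<omega>") (auto simp: numeral_2_eq_2 simp del: occ_time.simps)
  also have "\<dots> \<longleftrightarrow> (\<forall>i\<in>{n<..n+m}. \<not> hit (history i \<omega>))"
    by (rule less_occ_Suc_iff[OF enat])
  also have "\<dots> \<longleftrightarrow> \<not> (\<exists>n. (first U n \<omega> \<or> first D n \<omega>) \<and> (\<exists>i\<in>{n<..n+m}. hit (history i \<omega>)))"
    using enat unfolding occ_1_eq_iff[symmetric] by auto
  finally show ?thesis .
next
  case infinity
  then have "gap Y U D 2 \<omega> = \<infinity>"
    using occ_Suc_infinite[of 1 \<omega>] by (simp add: gap_def numeral_2_eq_2 del: occ_time.simps)
  then show ?thesis using infinity unfolding occ_1_eq_iff[symmetric] by simp
qed

lemma sign_1_gap_2_iff: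
  assumes "w \<in> {U, D}"
  shows "occ_sign Y U D 1 \<omega> = sign w \<and> enat m < gap Y U D 2 \<omega> \<longleftrightarrow>
    (\<exists>n. first w n \<omega> \<and> (\<forall>i\<in>{n<..n+m}. \<not> hit (history i \<omega>)))"
  unfolding sign_1_iff[OF assms] less_gap_2_iff
  using assms first_unique[of _ w] by blast

lemma sets_first [measurable]: "{\<omega>\<in>space M. first w n \<omega>} \<in> sets M"
  unfolding first_def by measurable

lemma sets_sign_1: "w \<in> {U, D} \<Longrightarrow> {\<omega>\<in>space M. occ_sign Y U D 1 \<omega> = sign w} \<in> sets M"
  unfolding sign_1_iff by measurable

lemma sets_gap_2: "{\<omega>\<in>space M. enat m < gap Y U D 2 \<omega>} \<in> sets M"
  unfolding less_gap_2_iff by measurable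

lemma prob_first_quiet:
  assumes "w \<in> {U, D}"
  shows "\<P>(\<omega> in M. first w n \<omega> \<and> (\<forall>i\<in>{n<..n+m}. \<not> hit (history i \<omega>)))
    = \<P>(\<omega> in M. first w n \<omega>) * quiet_prob w m"
  using prob_quiet_after[OF assms, of "\<lambda>l. \<forall>i<n. \<not> hit (take i l)" n m] by (simp add: first_def min_absorb1)

text \<open>The event is split by the time of the first occurrence. The pieces are disjoint and
  share the factor \<open>quiet_prob w m\<close>, which comes out of the series.\<close>

lemma prob_sign_1_gap_2:
  assumes w: "w \<in> {U, D}"
  shows "\<P>(\<omega> in M. occ_sign Y U D 1 \<omega> = sign w \<and> enat m < gap Y U D 2 \<omega>)
    = \<P>(\<omega> in M. occ_sign Y U D 1 \<omega> = sign w) * quiet_prob w m"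
proof -
  let ?F = "\<lambda>n. {\<omega>\<in>space M. first w n \<omega>}"
  let ?G = "\<lambda>n. {\<omega>\<in>space M. first w n \<omega> \<and> (\<forall>i\<in>{n<..n+m}. \<not> hit (history i \<omega>))}"
  have disj: "disjoint_family ?F" "disjoint_family ?G"
    using first_unique[OF w w] unfolding disjoint_family_on_def by blast+
  have "(\<lambda>n. prob (?F n)) sums prob (\<Union>n. ?F n)"
    using disj by (intro finite_measure_UNION) auto
  moreover have "(\<Union>n. ?F n) = {\<omega>\<in>space M. occ_sign Y U D 1 \<omega> = sign w}"
    using sign_1_iff[OF w] by blast
  ultimately have "(\<lambda>n. prob (?F n) * quiet_prob w m) sums
      (\<P>(\<omega> in M. occ_sign Y U D 1 \<omega> = sign w) * quiet_prob w m)"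
    by (intro sums_mult2) simp
  moreover have "(\<lambda>n. prob (?F n) * quiet_prob w m) sums prob (\<Union>n. ?G n)"
    unfolding prob_first_quiet[OF w, symmetric] using disj by (intro finite_measure_UNION) auto
  ultimately have "prob (\<Union>n. ?G n) = \<P>(\<omega> in M. occ_sign Y U D 1 \<omega> = sign w) * quiet_prob w m"
    by (rule sums_unique2[symmetric])
  also have "(\<Union>n. ?G n) = {\<omega>\<in>space M. occ_sign Y U D 1 \<omega> = sign w \<and> enat m < gap Y U D 2 \<omega>}"
    using sign_1_gap_2_iff[OF w] by blast
  finally show ?thesis .
qed

text \<open>If the chain opens with \<open>w\<close>, no pattern can end before \<open>w\<close>
  does: it would be a shorter word contained in \<open>w\<close>. Positivity makes conditioning on
  the first sign meaningful.\<close>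

lemma prob_sign_1_pos:
  assumes w: "w \<in> {U, D}"
  shows "\<P>(\<omega> in M. occ_sign Y U D 1 \<omega> = sign w) > 0"
proof -
  have "first w (length w) \<omega>" if "history (length w) \<omega> = w" for \<omega>
  proof -
    have "\<not> hit (history i \<omega>)" if i: "i < length w" for i
    proof
      assume "hit (history i \<omega>)"
      then obtain v where v: "v \<in> {U, D}" "suffix v (history i \<omega>)" by (auto simp: hit_iff)
      have "history i \<omega> = take i w"
        using arg_cong[OF \<open>history (length w) \<omega> = w\<close>, of "take i"] i by (simp add: min_def)
      then obtain l where "take i w = l @ v" using v(2) by (auto simp: suffix_def)
      then have "w = l @ v @ drop i w" by (metis append.assoc append_take_drop_id)
      then have "sublist v w" unfolding sublist_def by blast
      moreover have "length v \<le> i" using suffix_length_le[OF v(2)] by simp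
      ultimately show False using not_sublist[OF v(1) w] i by auto
    qed
    then show ?thesis using that by (simp add: first_def)
  qed
  then have "\<P>(\<omega> in M. history (length w) \<omega> = w) \<le> \<P>(\<omega> in M. occ_sign Y U D 1 \<omega> = sign w)"
    using sets_sign_1[OF w] by (intro finite_measure_mono) (auto simp: sign_1_iff[OF w, unfolded One_nat_def])
  with possible[OF w] show ?thesis by linarith
qed

text \<open>Dividing by the probability of the first sign leaves \<open>quiet_prob w\<close> as the
  conditional tail of the second gap.\<close>

lemma cond_mean_gap_2:
  assumes w: "w \<in> {U, D}"
  shows "cond_mean_time M (gap Y U D 2) (\<lambda>\<omega>. occ_sign Y U D 1 \<omega> = sign w) = ennreal (suminf (quiet_prob w))"
proof -
  let ?E = "{\<omega>\<in>space M. occ_sign Y U D 1 \<omega> = sign w}"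
  have pos: "emeasure M ?E \<noteq> 0" "emeasure M ?E \<noteq> \<infinity>"
    using prob_sign_1_pos[OF w] by (auto simp: emeasure_eq_measure)
  show ?thesis
    unfolding cond_mean_time_def
  proof (rule mean_time_sums)
    show "prob_space (uniform_measure M ?E)"
      using pos by (rule prob_space_uniform_measure)
    show "{\<omega>\<in>space (uniform_measure M ?E). enat m < gap Y U D 2 \<omega>} \<in> sets (uniform_measure M ?E)" for m
      using sets_gap_2 by simp
    show "quiet_prob w sums suminf (quiet_prob w)"
      by (intro summable_sums summable_quiet_prob w)
    show "\<P>(\<omega> in uniform_measure M ?E. enat m < gap Y U D 2 \<omega>) = quiet_prob w m" for m
    proof -
      have "\<P>(\<omega> in uniform_measure M ?E. enat m < gap Y U D 2 \<omega>)
          = prob (?E \<inter> {\<omega>\<in>space M. enat m < gap Y U D 2 \<omega>}) / prob ?E"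
        using pos sets_gap_2 by (subst measure_uniform_measure) auto
      also have "?E \<inter> {\<omega>\<in>space M. enat m < gap Y U D 2 \<omega>}
          = {\<omega>\<in>space M. occ_sign Y U D 1 \<omega> = sign w \<and> enat m < gap Y U D 2 \<omega>}"
        by auto
      finally show ?thesis
        using prob_sign_1_gap_2[OF w] prob_sign_1_pos[OF w] by simp
    qed
  qed
qed

lemma mean_gap_1:
  "mean_time M (gap Y U D 1) = ennreal (\<Sum>n. \<P>(\<omega> in M. quiet [] (history n \<omega>)))"
proof -
  have "enat n < gap Y U D 1 \<omega> \<longleftrightarrow> quiet [] (history n \<omega>)" for n \<omega>
    unfolding gap_def quiet_history using less_occ_Suc_iff[of 0 \<omega> 0 n] hit_pos[of _ \<omega>]
    by (auto simp: zero_enat_def[symmetric] simp del: occ_time.simps(2))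
  then show ?thesis
    using prob_space_axioms summable_sums[OF summable_quiet]
    by (intro mean_time_sums[where f = "\<lambda>n. \<P>(\<omega> in M. quiet [] (history n \<omega>))"]) auto
qed

section \<open>Two consecutive signs and the use of aperiodicity\<close>

lemma sign_1_2_iff:
  assumes "v \<in> {U, D}" "w \<in> {U, D}"
  shows "occ_sign Y U D 1 \<omega> = sign v \<and> occ_sign Y U D 2 \<omega> = sign w \<longleftrightarrow>
    (\<exists>m n. first v m \<omega> \<and> m < n \<and> (\<forall>i\<in>{m<..<n}. \<not> hit (history i \<omega>)) \<and> suffix w (history n \<omega>))"
proof -
  have "occ_sign Y U D 2 \<omega> = sign w \<longleftrightarrow>
      (\<exists>n. m < n \<and> (\<forall>i\<in>{m<..<n}. \<not> hit (history i \<omega>)) \<and> suffix w (history n \<omega>))"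
    if m: "first v m \<omega>" for m
  proof -
    have occ1: "occ_time Y U D 1 \<omega> = enat m"
      using m assms unfolding occ_1_eq_iff by auto
    note occ2 = occ_Suc_eq_iff[OF occ1, unfolded Suc_1]
    show ?thesis
    proof (cases "occ_time Y U D 2 \<omega>")
      case (enat n)
      then have n: "m < n" "hit (history n \<omega>)" "\<forall>i\<in>{m<..<n}. \<not> hit (history i \<omega>)"
        using occ2 by auto
      have "occ_sign Y U D 2 \<omega> = sign w \<longleftrightarrow> suffix w (history n \<omega>)"
        using occ_sign_eq_step[OF enat n(2)] step_eq_sign_iff[OF assms(2)] by simp
      moreover have "k = n" if "m < k" "\<forall>i\<in>{m<..<k}. \<not> hit (history i \<omega>)" "suffix w (history k \<omega>)" for k
      proof -
        have "hit (history k \<omega>)" using that assms by (auto simp: hit_iff)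
        then show ?thesis using occ2[of k] that enat by auto
      qed
      ultimately show ?thesis using n by blast
    next
      case infinity
      then have "\<not> (m < n \<and> hit (history n \<omega>) \<and> (\<forall>i\<in>{m<..<n}. \<not> hit (history i \<omega>)))" for n
        using occ2[of n] by simp
      moreover have "occ_sign Y U D 2 \<omega> \<noteq> sign w"
        using infinity by (simp add: occ_sign_def sign_def del: occ_time.simps)
      ultimately show ?thesis using assms by (auto simp: hit_iff)
    qed
  qed
  then show ?thesis unfolding sign_1_iff[OF assms(1)] by blast
qed

lemma sets_sign_1_2:
  assumes "v \<in> {U, D}" "w \<in> {U, D}"
  shows "{\<omega>\<in>space M. occ_sign Y U D 1 \<omega> = sign v \<and> occ_sign Y U D 2 \<omega> = sign w} \<in> sets M"
  unfolding sign_1_2_iff[OF assms] by measurable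

text \<open>If all paths from \<open>v\<close> to a next occurrence \<open>w\<close> have
  probability 0, the event is null for each pair of occurrence times, and there are countably many
  pairs.\<close>

lemma AE_no_transition:
  assumes v: "v \<in> {U, D}" and w: "w \<in> {U, D}"
    and none: "\<And>r. set r \<subseteq> \<Delta> \<Longrightarrow> r \<noteq> [] \<Longrightarrow> quiet v (butlast r) \<Longrightarrow> suffix w (v @ r) \<Longrightarrow> path_prob p (last v) r \<le> 0"
  shows "AE \<omega> in M. \<not> (occ_sign Y U D 1 \<omega> = sign v \<and> occ_sign Y U D 2 \<omega> = sign w)"
proof -
  have "AE \<omega> in M. \<not> (first v m \<omega> \<and> m < n \<and> (\<forall>i\<in>{m<..<n}. \<not> hit (history i \<omega>)) \<and> suffix w (history n \<omega>))" for m n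
  proof (cases "0 < m \<and> m < n")
    case True
    \<comment> \<open>\<open>Q\<close> drops the demand that \<open>v\<close> be the first
      occurrence, since only the stretch after time \<open>m\<close> matters.\<close>
    define Q where "Q l \<longleftrightarrow> suffix v (take m l) \<and> (\<forall>i\<in>{m<..<n}. \<not> hit (take i l)) \<and> suffix w l" for l
    have zero: "of_bool (Q (l @ r)) * path_prob p (last l) r = 0"
      if l: "l \<in> words \<Delta> m" and r: "r \<in> words \<Delta> (n - m)" for l r
    proof (cases "Q (l @ r)")
      case Q: True
      then have sl: "suffix v l" using l by (simp add: Q_def words_def)
      then have last: "last l = last v" using nonempty[OF v] by (auto simp: suffix_def)
      have "quiet v (butlast r)"
        unfolding quiet_def
      proof
        fix i assume i: "i \<in> {1..length (butlast r)}"
        then have "m + i \<in> {m<..<n}" using r by (auto simp: words_def)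
        then have "\<not> hit (take (m + i) (l @ r))" using Q unfolding Q_def by blast
        moreover have "take (m + i) (l @ r) = l @ take i (butlast r)"
          using l i by (auto simp: words_def take_butlast)
        ultimately show "\<not> hit (v @ take i (butlast r))" using hit_forget[OF v sl] by simp
      qed
      moreover have "suffix w (v @ r)" using Q suffix_forget[OF w v sl] by (simp add: Q_def)
      moreover have "set r \<subseteq> \<Delta>" "r \<noteq> []" using r True by (auto simp: words_def)
      ultimately have "path_prob p (last v) r = 0"
        using none[of r] path_prob_nonneg[OF fin stoch last_pattern[OF v], of r] by simp
      then show ?thesis by (simp add: last)
    qed simp
    have m: "0 < m" using True by simp
    have "\<P>(\<omega> in M. Q (history (m + (n - m)) \<omega>)) = 0"
      unfolding prob_history_add[OF m]
    proof (intro sum.neutral ballI)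
      fix l assume "l \<in> words \<Delta> m"
      then have "(\<Sum>r\<in>words \<Delta> (n - m). of_bool (Q (l @ r)) * path_prob p (last l) r) = 0"
        using zero by (intro sum.neutral) blast
      then show "\<P>(\<omega> in M. history m \<omega> = l) *
          (\<Sum>r\<in>words \<Delta> (n - m). of_bool (Q (l @ r)) * path_prob p (last l) r) = 0"
        by (simp only: mult_zero_right)
    qed
    then have "AE \<omega> in M. \<not> Q (history n \<omega>)"
      using True by (subst (asm) prob_eq_0) auto
    then show ?thesis
      by (rule AE_mp) (use True in \<open>auto simp: Q_def first_def min_def intro!: AE_I2\<close>)
  next
    case False
    then have "\<not> (first v m \<omega> \<and> m < n)" for \<omega>
      using nonempty[OF v] by (cases m) (auto simp: first_def)
    then show ?thesis by (intro AE_I2) blast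
  qed
  then show ?thesis
    unfolding sign_1_2_iff[OF v w] not_ex AE_all_countable by blast
qed

text \<open>If \<open>v\<close> could not be followed by itself, the second sign after
  \<open>v\<close> would almost surely be the opposite one. This is how aperiodicity yields the path
  repeated in \<open>summable_in_strip\<close>.\<close>

lemma transition_possible:
  assumes v: "v \<in> {U, D}"
    and ap: "\<P>(\<omega> in M. occ_sign Y U D 2 \<omega> = - sign v \<bar> occ_sign Y U D 1 \<omega> = sign v) \<noteq> 1"
  shows "\<exists>r. set r \<subseteq> \<Delta> \<and> path_prob p (last v) r > 0 \<and> r \<noteq> [] \<and> quiet v (butlast r) \<and> suffix v (v @ r)"
proof (rule ccontr)
  assume "\<not> ?thesis"
  then have no_repeat: "AE \<omega> in M. \<not> (occ_sign Y U D 1 \<omega> = sign v \<and> occ_sign Y U D 2 \<omega> = sign v)"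
    by (intro AE_no_transition[OF v v]) (auto simp: not_less)
  \<comment> \<open>On \<open>N\<close> no second occurrence ever comes and the second sign is 0.
    The gap tails tend to 0, so \<open>N\<close> is null.\<close>
  define N where "N = {\<omega>\<in>space M. \<forall>m. occ_sign Y U D 1 \<omega> = sign v \<and> enat m < gap Y U D 2 \<omega>}"
  have N: "N \<in> sets M"
    unfolding N_def sign_1_gap_2_iff[OF v] by measurable
  have "prob N \<le> \<P>(\<omega> in M. occ_sign Y U D 1 \<omega> = sign v) * quiet_prob v m" for m
    unfolding prob_sign_1_gap_2[OF v, symmetric] N_def sign_1_gap_2_iff[OF v]
    by (intro finite_measure_mono) auto
  moreover have "(\<lambda>m. \<P>(\<omega> in M. occ_sign Y U D 1 \<omega> = sign v) * quiet_prob v m) \<longlonglongrightarrow> \<P>(\<omega> in M. occ_sign Y U D 1 \<omega> = sign v) * 0"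
    by (intro tendsto_mult tendsto_const summable_LIMSEQ_zero summable_quiet_prob v)
  ultimately have "prob N \<le> 0"
    by (intro LIMSEQ_le_const) auto
  then have "AE \<omega> in M. \<omega> \<notin> N"
    using prob_eq_0[OF N] by (simp add: measure_le_0_iff)
  with no_repeat have "AE \<omega> in M. occ_sign Y U D 1 \<omega> = sign v \<longrightarrow> occ_sign Y U D 2 \<omega> = - sign v"
  proof (rule AE_mp[OF AE_conjI], intro AE_I2 impI)
    fix \<omega> assume \<omega>: "\<omega> \<in> space M" and sign1: "occ_sign Y U D 1 \<omega> = sign v"
      and *: "\<not> (occ_sign Y U D 1 \<omega> = sign v \<and> occ_sign Y U D 2 \<omega> = sign v) \<and> \<omega> \<notin> N"
    have "occ_time Y U D 2 \<omega> \<noteq> \<infinity>"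
    proof
      assume "occ_time Y U D 2 \<omega> = \<infinity>"
      then have "gap Y U D 2 \<omega> = \<infinity>" by (simp add: gap_def del: occ_time.simps)
      then show False using * \<omega> sign1 by (simp add: N_def)
    qed
    then obtain n where n: "occ_time Y U D 2 \<omega> = enat n" by auto
    then have hit: "hit (history n \<omega>)" using hits_occ_time[OF n] by simp
    then have "step (history n \<omega>) \<noteq> 0"
      using suffix_unique[of U D "history n \<omega>"] U_neq_D by (auto simp: step_def hit_def)
    then show "occ_sign Y U D 2 \<omega> = - sign v"
      using * sign1 occ_sign_eq_step[OF n hit] step_range[of "history n \<omega>"] by (auto simp: sign_def split: if_splits)
  qed
  moreover have "\<exists>w\<in>{U, D}. - sign v = sign w"
    using v U_neq_D by (auto simp: sign_def)
  then obtain w where w: "w \<in> {U, D}" "- sign v = sign w" by blast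
  ultimately have "\<P>(\<omega> in M. occ_sign Y U D 2 \<omega> = sign w \<and> occ_sign Y U D 1 \<omega> = sign v) = \<P>(\<omega> in M. occ_sign Y U D 1 \<omega> = sign v)"
    using sets_sign_1[OF v] sets_sign_1_2[OF v w(1)]
    by (intro finite_measure_eq_AE) (auto simp: conj_commute)
  then show False
    using ap prob_sign_1_pos[OF v] by (simp add: cond_prob_def w)
qed

section \<open>Expected visits before exit and the mean exit times\<close>

lemma measurable_of_bool_history [measurable]:
  "(\<lambda>\<omega>. of_bool (Q (history n \<omega>)) :: ennreal) \<in> borel_measurable M"
proof -
  have "(\<lambda>\<omega>. indicator {\<omega>\<in>space M. Q (history n \<omega>)} \<omega> :: ennreal) \<in> borel_measurable M"
    by measurable
  then show ?thesis
    by (rule measurable_cong[THEN iffD1, rotated]) (auto simp: indicator_def)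
qed

lemma nn_integral_of_bool:
  assumes "{\<omega>\<in>space M. P \<omega>} \<in> sets M"
  shows "(\<integral>\<^sup>+ \<omega>. of_bool (P \<omega>) \<partial>M) = ennreal \<P>(\<omega> in M. P \<omega>)"
proof -
  have "(\<integral>\<^sup>+ \<omega>. of_bool (P \<omega>) \<partial>M) = (\<integral>\<^sup>+ \<omega>. indicator {\<omega>\<in>space M. P \<omega>} \<omega> \<partial>M)"
    by (intro nn_integral_cong) (auto simp: indicator_def)
  then show ?thesis using assms by (simp add: emeasure_eq_measure)
qed

text \<open>Aperiodicity enters here only through the summability assumption, which makes exit
  almost sure and the visit counts integrable.\<close>

context
  fixes A B :: int
  assumes AB: "A > 0" "B > 0"
    and summable: "summable (\<lambda>n. \<P>(\<omega> in M. in_strip A B (history n \<omega>)))"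
begin

abbreviation "\<tau> \<equiv> exit_time (score Y U D) A B"

text \<open>The number of occurrences of \<open>w\<close> strictly before exit, written as a series
  of indicators so that its mean is the series of \<open>visit_prob\<close>.\<close>

definition visits :: "'a list \<Rightarrow> 'w \<Rightarrow> ennreal" where
  "visits w \<omega> = (\<Sum>j. of_bool (in_strip A B (history j \<omega>) \<and> suffix w (history j \<omega>)))"

lemma measurable_visit:
  "(\<lambda>\<omega>. of_bool (in_strip A B (history j \<omega>) \<and> suffix w (history j \<omega>)) :: ennreal) \<in> borel_measurable M"
  by (rule measurable_of_bool_history[of "\<lambda>l. in_strip A B l \<and> suffix w l"])

lemma measurable_visits [measurable]: "visits w \<in> borel_measurable M"
  unfolding visits_def using measurable_visit by (rule borel_measurable_suminf_order)

lemma nn_integral_visits: "(\<integral>\<^sup>+ \<omega>. visits w \<omega> \<partial>M) = ennreal (suminf (visit_prob A B w))"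
proof -
  have "(\<integral>\<^sup>+ \<omega>. visits w \<omega> \<partial>M) =
      (\<Sum>j. \<integral>\<^sup>+ \<omega>. of_bool (in_strip A B (history j \<omega>) \<and> suffix w (history j \<omega>)) \<partial>M)"
    unfolding visits_def by (intro nn_integral_suminf measurable_visit)
  also have "\<dots> = (\<Sum>j. ennreal (visit_prob A B w j))"
    unfolding visit_prob_def
    by (intro arg_cong[where f = suminf] ext nn_integral_of_bool
        sets_history[of "\<lambda>l. in_strip A B l \<and> suffix w l"])
  also have "\<dots> = ennreal (suminf (visit_prob A B w))"
    by (intro suminf_ennreal_eq visit_prob_nonneg summable_sums summable_visit_prob summable)
  finally show ?thesis .
qed

lemma AE_exit: "AE \<omega> in M. \<exists>n. \<tau> \<omega> = enat n"
  using AE_history_finite[OF summable]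
proof (rule AE_mp, intro AE_I2 impI)
  fix \<omega> assume "\<exists>n. \<not> in_strip A B (history n \<omega>)"
  then obtain n where "\<not> enat n < \<tau> \<omega>" unfolding less_exit_time_iff by blast
  then show "\<exists>n. \<tau> \<omega> = enat n" by (cases "\<tau> \<omega>") auto
qed

lemma mean_exit_time:
  "mean_time M \<tau> = ennreal ((\<Sum>n. \<P>(\<omega> in M. quiet [] (history n \<omega>))) +
     (\<Sum>w\<in>{U, D}. suminf (visit_prob A B w) * suminf (quiet_prob w)))"
  using sums_in_strip[OF AB summable] prob_space_axioms
  by (intro mean_time_sums[where f = "\<lambda>n. \<P>(\<omega> in M. in_strip A B (history n \<omega>))"])
    (auto simp: less_exit_time_iff)

text \<open>The summand 1 is the occurrence at which exit happens; every earlier one is a visit to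
  \<open>U\<close> or to \<open>D\<close>.\<close>

lemma mean_exit_time_signs:
  "mean_time M (exit_time (\<lambda>k \<omega>. \<Sum>j=1..k. occ_sign Y U D j \<omega>) A B)
    = 1 + ennreal (suminf (visit_prob A B U)) + ennreal (suminf (visit_prob A B D))"
proof -
  have "mean_time M (exit_time (\<lambda>k \<omega>. \<Sum>j=1..k. occ_sign Y U D j \<omega>) A B)
      = (\<integral>\<^sup>+ \<omega>. 1 + visits U \<omega> + visits D \<omega> \<partial>M)"
    unfolding mean_time_def
  proof (rule nn_integral_cong_AE, rule AE_mp[OF AE_exit], intro AE_I2 impI)
    fix \<omega> assume "\<exists>n. \<tau> \<omega> = enat n"
    then obtain n where n: "\<tau> \<omega> = enat n" by blast
    then obtain k where k: "n = Suc k"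
      using exit_time_finite(2)[OF AB n] by (cases n) auto
    have "hits n \<omega> = 1 + hits k \<omega>"
      using exit_time_finite(1)[OF AB n] by (simp add: k hits_Suc)
    also have "hits k \<omega> = card {j\<in>{..<n}. suffix U (history j \<omega>)} + card {j\<in>{..<n}. suffix D (history j \<omega>)}"
      using card_visits(1)[where n = k and \<omega> = \<omega>] by (simp add: k lessThan_Suc_atMost)
    finally have "(of_nat (hits n \<omega>) :: ennreal) = 1 + visits U \<omega> + visits D \<omega>"
      unfolding visits_def visits_before_exit[OF AB n] by (simp add: add.assoc)
    then show "ennreal_of_enat (exit_time (\<lambda>k \<omega>. \<Sum>j=1..k. occ_sign Y U D j \<omega>) A B \<omega>)
        = 1 + visits U \<omega> + visits D \<omega>"
      unfolding exit_time_signs[OF AB n] by simp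
  qed
  also have "\<dots> = 1 + ennreal (suminf (visit_prob A B U)) + ennreal (suminf (visit_prob A B D))"
    by (simp add: nn_integral_add nn_integral_visits emeasure_space_1)
  finally show ?thesis .
qed

text \<open>The difference of the visit counts is the level just before exit, \<open>A - 1\<close>
  on the event of probability \<open>\<alpha>\<close> and \<open>1 - B\<close> almost surely
  elsewhere. Terms that would be negative are moved to the other side, so that the integrals stay in
  \<open>ennreal\<close>.\<close>

lemma visit_balance:
  defines "\<alpha> \<equiv> \<P>(\<omega> in M. \<exists>n. \<tau> \<omega> = enat n \<and> score Y U D n \<omega> = A)"
  shows "suminf (visit_prob A B U) + (of_int B - 1) * (1 - \<alpha>) = suminf (visit_prob A B D) + (of_int A - 1) * \<alpha>"
proof -
  define H where "H = {\<omega>\<in>space M. \<exists>n. \<tau> \<omega> = enat n \<and> score Y U D n \<omega> = A}"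
  have H: "H \<in> sets M"
    unfolding H_def exit_time_def Inf_enat_eq_iff score_eq_level by measurable
  have \<alpha>: "prob H = \<alpha>" by (simp add: \<alpha>_def H_def)
  have compl: "prob (space M - H) = 1 - \<alpha>" using prob_compl[OF H] \<alpha> by simp
  have V: "0 \<le> suminf (visit_prob A B w)" for w
    by (intro suminf_nonneg visit_prob_nonneg summable_visit_prob summable)
  have "(\<integral>\<^sup>+ \<omega>. visits U \<omega> + of_nat (nat (B - 1)) * indicator (space M - H) \<omega> \<partial>M)
      = (\<integral>\<^sup>+ \<omega>. visits D \<omega> + of_nat (nat (A - 1)) * indicator H \<omega> \<partial>M)"
  proof (rule nn_integral_cong_AE, rule AE_mp[OF AE_exit], intro AE_I2 impI)
    fix \<omega> assume \<omega>: "\<omega> \<in> space M" and "\<exists>n. \<tau> \<omega> = enat n"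
    then obtain n where n: "\<tau> \<omega> = enat n" by blast
    then obtain k where k: "n = Suc k"
      using exit_time_finite(2)[OF AB n] by (cases n) auto
    define u where "u = card {j\<in>{..<n}. suffix U (history j \<omega>)}"
    define d where "d = card {j\<in>{..<n}. suffix D (history j \<omega>)}"
    have ud: "int u - int d = level (history (n - 1) \<omega>)"
      using card_visits(2)[where n = k and \<omega> = \<omega>] by (simp add: u_def d_def k lessThan_Suc_atMost)
    have visits: "visits U \<omega> = of_nat u" "visits D \<omega> = of_nat d"
      unfolding visits_def visits_before_exit[OF AB n] u_def d_def by simp_all
    have H_iff: "\<omega> \<in> H \<longleftrightarrow> level (history n \<omega>) = A"
      using \<omega> n by (simp add: H_def score_eq_level)
    show "visits U \<omega> + of_nat (nat (B - 1)) * indicator (space M - H) \<omega>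
        = visits D \<omega> + of_nat (nat (A - 1)) * indicator H \<omega>"
    proof (cases "\<omega> \<in> H")
      case True
      then have "u = d + nat (A - 1)"
        using exit_time_finite(4)[OF AB n] H_iff ud AB by auto
      then show ?thesis using True by (simp add: visits)
    next
      case False
      then have "u + nat (B - 1) = d"
        using exit_time_finite(4)[OF AB n] H_iff ud AB by auto
      then show ?thesis using False \<omega> by (simp add: visits flip: of_nat_add)
    qed
  qed
  then have "ennreal (suminf (visit_prob A B U)) + of_nat (nat (B - 1)) * ennreal (1 - \<alpha>)
      = ennreal (suminf (visit_prob A B D)) + of_nat (nat (A - 1)) * ennreal \<alpha>"
    using H by (simp add: nn_integral_add nn_integral_cmult nn_integral_visits emeasure_eq_measure \<alpha> compl)
  moreover have "ennreal u + of_nat n * ennreal x = ennreal (u + real n * x)" if "0 \<le> u" "0 \<le> x" for u x n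
    using that by (simp add: ennreal_of_nat_eq_real_of_nat ennreal_mult)
  moreover have \<alpha>_bounds: "0 \<le> \<alpha>" "0 \<le> 1 - \<alpha>"
    unfolding \<alpha>[symmetric] by simp_all
  ultimately have "ennreal (suminf (visit_prob A B U) + real (nat (B - 1)) * (1 - \<alpha>))
      = ennreal (suminf (visit_prob A B D) + real (nat (A - 1)) * \<alpha>)"
    using V by metis
  then have "suminf (visit_prob A B U) + real (nat (B - 1)) * (1 - \<alpha>)
      = suminf (visit_prob A B D) + real (nat (A - 1)) * \<alpha>"
    using V \<alpha>_bounds by (subst (asm) ennreal_inj) auto
  then show ?thesis using AB by simp
qed

end

end

text \<open>The finiteness claims are part of the conclusion because \<open>enn2real\<close> sends
  \<open>\<infinity>\<close> to 0; only with them does the real equation speak about the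
  means.\<close>

theorem proposition2:
  fixes M :: "'w measure" and \<Delta> :: "'a set" and p :: "'a \<Rightarrow> 'a \<Rightarrow> real"
    and Y :: "nat \<Rightarrow> 'w \<Rightarrow> 'a" and U D :: "'a list" and A B :: int
    and S X :: "nat \<Rightarrow> 'w \<Rightarrow> int" and \<gamma> :: "nat \<Rightarrow> 'w \<Rightarrow> enat" and \<tau> T :: "'w \<Rightarrow> enat"
    and \<alpha> a b :: real
  assumes "prob_space M"
    and "finite \<Delta>" and "card \<Delta> \<ge> 2"
    and "homogeneous_markov_chain M \<Delta> p Y" and "irreducible_on \<Delta> p"
    and "set U \<subseteq> \<Delta>" and "set D \<subseteq> \<Delta>"
    and "length U \<ge> 1" and "length D \<ge> 1" and "U \<noteq> D"
    and "\<not> sublist U D" and "\<not> sublist D U"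
    and "\<P>(\<omega> in M. \<forall>j<length U. Y (j + 1) \<omega> = U ! j) > 0"
    and "\<P>(\<omega> in M. \<forall>j<length D. Y (j + 1) \<omega> = D ! j) > 0"
    and "A > 0" and "B > 0"
    and "S = score Y U D"
    and "\<tau> = exit_time S A B"
    and "\<gamma> = gap Y U D"
    and "X = occ_sign Y U D"
    and "T = exit_time (\<lambda>k \<omega>. \<Sum>j=1..k. X j \<omega>) A B"
    and "aperiodic_signs M X"
    and "\<alpha> = \<P>(\<omega> in M. \<exists>n. \<tau> \<omega> = enat n \<and> S n \<omega> = A)"
    and "a = (enn2real (cond_mean_time M (\<gamma> 2) (\<lambda>\<omega>. X 1 \<omega> = 1))
            - enn2real (cond_mean_time M (\<gamma> 2) (\<lambda>\<omega>. X 1 \<omega> = - 1))) / 2"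
    and "b = (enn2real (cond_mean_time M (\<gamma> 2) (\<lambda>\<omega>. X 1 \<omega> = 1))
            + enn2real (cond_mean_time M (\<gamma> 2) (\<lambda>\<omega>. X 1 \<omega> = - 1))) / 2"
  shows "mean_time M \<tau> < \<infinity> \<and> mean_time M (\<gamma> 1) < \<infinity> \<and> mean_time M T < \<infinity>
    \<and> cond_mean_time M (\<gamma> 2) (\<lambda>\<omega>. X 1 \<omega> = 1) < \<infinity>
    \<and> cond_mean_time M (\<gamma> 2) (\<lambda>\<omega>. X 1 \<omega> = - 1) < \<infinity>
    \<and> enn2real (mean_time M \<tau>) =
        enn2real (mean_time M (\<gamma> 1))
        + a * ((of_int A + of_int B - 2) * \<alpha> - (of_int B - 1))
        + b * (enn2real (mean_time M T) - 1)"
proof -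
  interpret finite_chain M \<Delta> p Y
    using assms(1,2,4) by (simp add: finite_chain_def finite_chain_axioms_def)
  have history: "history (length w) \<omega> = w \<longleftrightarrow> (\<forall>j<length w. Y (j + 1) \<omega> = w ! j)" for w \<omega>
    by (auto simp: list_eq_iff_nth_eq nth_history)
  interpret two_patterns M \<Delta> p Y U D
    by unfold_locales (use assms(5-14) in \<open>auto simp: history[unfolded Suc_eq_plus1]\<close>)
  let ?V = "\<lambda>w. suminf (visit_prob A B w)" and ?G = "\<lambda>w. suminf (quiet_prob w)"
  \<comment> \<open>Some pattern is not almost surely followed by the other one; its return path
    makes the strip probabilities summable.\<close>
  have "\<exists>w\<in>{U, D}. \<P>(\<omega> in M. X 2 \<omega> = - sign w \<bar> X 1 \<omega> = sign w) \<noteq> 1"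
    using assms(22) U_neq_D by (auto simp: aperiodic_signs_def sign_def)
  then obtain w r where w: "w \<in> {U, D}" and r: "set r \<subseteq> \<Delta>" "path_prob p (last w) r > 0"
    "r \<noteq> []" "quiet w (butlast r)" "suffix w (w @ r)"
    using transition_possible assms(20) by blast
  note summable = summable_in_strip[OF assms(15,16) w r]
  note exit_facts = assms(15,16) summable
  have V: "0 \<le> ?V w" for w
    by (intro suminf_nonneg visit_prob_nonneg summable_visit_prob summable)
  have G: "0 \<le> ?G w" if "w \<in> {U, D}" for w
    using that by (intro suminf_nonneg quiet_prob_nonneg summable_quiet_prob)
  have q: "0 \<le> (\<Sum>n. \<P>(\<omega> in M. quiet [] (history n \<omega>)))"
    by (intro suminf_nonneg summable_quiet) simp
  have \<gamma>2: "cond_mean_time M (\<gamma> 2) (\<lambda>\<omega>. X 1 \<omega> = 1) = ennreal (?G U)"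
    "cond_mean_time M (\<gamma> 2) (\<lambda>\<omega>. X 1 \<omega> = - 1) = ennreal (?G D)"
    using cond_mean_gap_2[of U] cond_mean_gap_2[of D] U_neq_D by (simp_all add: sign_def assms(19,20))
  have \<gamma>1: "mean_time M (\<gamma> 1) = ennreal (\<Sum>n. \<P>(\<omega> in M. quiet [] (history n \<omega>)))"
    unfolding assms(19) by (rule mean_gap_1)
  have \<tau>: "mean_time M \<tau> = ennreal ((\<Sum>n. \<P>(\<omega> in M. quiet [] (history n \<omega>))) + (?V U * ?G U + ?V D * ?G D))"
    using mean_exit_time[OF exit_facts] U_neq_D by (simp add: assms(17,18))
  have T: "mean_time M T = ennreal (1 + ?V U + ?V D)"
    using mean_exit_time_signs[OF exit_facts] V by (simp add: assms(20,21))
  have balance: "?V U + (of_int B - 1) * (1 - \<alpha>) = ?V D + (of_int A - 1) * \<alpha>"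
    using visit_balance[OF exit_facts] by (simp only: assms(17,18,23))
  have diff: "(of_int A + of_int B - 2) * \<alpha> - (of_int B - 1) = ?V U - ?V D"
    using balance by (simp add: algebra_simps)
  \<comment> \<open>This is \<open>x * p + y * q = (p - q) / 2 * (x - y) + (p + q) / 2 * (x +
    y)\<close>, with visit counts \<open>x\<close>, \<open>y\<close> and mean gaps \<open>p\<close>,
    \<open>q\<close>.\<close>
  have "(?V U * ?G U + ?V D * ?G D) =
      a * ((of_int A + of_int B - 2) * \<alpha> - (of_int B - 1)) + b * (?V U + ?V D)"
    unfolding diff assms(24,25) \<gamma>2 using G by (simp add: field_simps)
  moreover have "enn2real (mean_time M \<tau>) =
      (\<Sum>n. \<P>(\<omega> in M. quiet [] (history n \<omega>))) + (?V U * ?G U + ?V D * ?G D)"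
    unfolding \<tau> using V G q by (intro enn2real_ennreal add_nonneg_nonneg mult_nonneg_nonneg) auto
  moreover have "enn2real (mean_time M T) = 1 + ?V U + ?V D"
    unfolding T using V by (intro enn2real_ennreal add_nonneg_nonneg) auto
  moreover have "enn2real (mean_time M (\<gamma> 1)) = (\<Sum>n. \<P>(\<omega> in M. quiet [] (history n \<omega>)))"
    unfolding \<gamma>1 using q by (rule enn2real_ennreal)
  moreover have "mean_time M \<tau> < \<infinity> \<and> mean_time M (\<gamma> 1) < \<infinity> \<and> mean_time M T < \<infinity>
    \<and> cond_mean_time M (\<gamma> 2) (\<lambda>\<omega>. X 1 \<omega> = 1) < \<infinity>
    \<and> cond_mean_time M (\<gamma> 2) (\<lambda>\<omega>. X 1 \<omega> = - 1) < \<infinity>"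
    unfolding \<tau> \<gamma>1 T \<gamma>2 by (simp only: infinity_ennreal_def ennreal_less_top)
  ultimately show ?thesis by simp
qed

end
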